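(* Let $\mathbb{F}$ and $\mathbb{K}$ be finite fields. Then $\mathrm{char}(\mathbb{F}) = \mathrm{char}(\mathbb{K})$ if and only if for each network $\mathcal{N}$ we have $\mathcal{R}_{lin}(\mathcal{N},\mathbb{F}) = \mathcal{R}_{lin}(\mathcal{N},\mathbb{K})$.
   Context: A network is a finite directed acyclic multigraph, some of whose nodes are sources or receivers, with finitely many message vectors (say $m$ of them), each originating at a source node; each receiver demands a specified set of the message vectors. The inputs of a node are the message vectors originating at the node together with the vectors carried by its incoming edges. For integers $k_1,\dots,k_m\ge 0$ and $n\ge 1$, a $(k_1,\dots,k_m,n)$ code over a finite alphabet $\mathcal{A}$ (with $|\mathcal{A}|\ge 2$) lets the $i$th message vector range over $\mathcal{A}^{k_i}$, assigns to each edge an edge function mapping the inputs of the edge's tail node to a vector in $\mathcal{A}^n$ (the vector carried by the edge), and assigns to each receiver and each message vector it demands a decoding function of the receiver's inputs. The code is a solution if, for all values of the message vectors, each decoding function outputs the demanded message vector. Its rate vector is $(k_1/n,\dots,k_m/n)$. For a finite field $\mathbb{F}$, a $(k_1,\dots,k_m,n)$ code over the alphabet $\mathbb{F}$ is linear if every edge function and decoding function is of the form $\mathbf{x}\mapsto A\mathbf{x}$, where $\mathbf{x}$ is the concatenation of the input vectors of the node and $A$ is a matrix over $\mathbb{F}$. A rate vector $\mathbf{r}$ is linearly achievable for $\mathcal{N}$ over $\mathbb{F}$ if $\mathcal{N}$ has a linear solution over $\mathbb{F}$ (for some block sizes $k_1,\dots,k_m,n$) with rate vector $\mathbf{r}$.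 The linear rate region is $\mathcal{R}_{lin}(\mathcal{N},\mathbb{F})=\{\mathbf{r}\in\mathbb{Q}^m : \mathbf{r}\text{ is linearly achievable for }\mathcal{N}\text{ over }\mathbb{F}\}$. *)

theory Defs
  imports
    "Jordan_Normal_Form.Matrix"
    "Graph_Theory.Digraph"
    "HOL-Computational_Algebra.Computational_Algebra"
begin

text \<open>
  Nodes and edges are named by natural numbers, which covers every finite multigraph up to
  isomorphism and fixes an order in which the inputs of a node are listed.
  The messages are the numbers below \<open>num_msgs\<close>.
\<close>

record network =
  graph :: "(nat, nat) pre_digraph"
  sources :: "nat set"
  receivers :: "nat set"
  num_msgs :: nat
  origin :: "nat \<Rightarrow> nat"
  demands :: "nat \<Rightarrow> nat set"

definition is_network :: "network \<Rightarrow> bool" where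
  "is_network N \<longleftrightarrow>
     fin_digraph (graph N) \<and> acyclic (arcs_ends (graph N)) \<and>
     sources N \<subseteq> verts (graph N) \<and> receivers N \<subseteq> verts (graph N) \<and>
     (\<forall>i<num_msgs N. origin N i \<in> sources N) \<and>
     (\<forall>v\<in>receivers N. demands N v \<subseteq> {..<num_msgs N})"

text \<open>
  \<^term>\<open>Inl i\<close> stands for message \<open>i\<close>, \<^term>\<open>Inr e\<close> for the vector carried by edge \<open>e\<close>.
\<close>

definition inputs :: "network \<Rightarrow> nat \<Rightarrow> (nat + nat) list" where
  "inputs N v =
     map Inl (sorted_list_of_set {i. i < num_msgs N \<and> origin N i = v}) @
     map Inr (sorted_list_of_set (in_arcs (graph N) v))"

text \<open>The alphabet is (the universe of) the type \<open>'a\<close>.\<close>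

record 'a code =
  msg_len :: "nat \<Rightarrow> nat"
  edge_len :: nat
  edge_fun :: "nat \<Rightarrow> 'a vec list \<Rightarrow> 'a vec"
  dec_fun :: "nat \<Rightarrow> nat \<Rightarrow> 'a vec list \<Rightarrow> 'a vec"

definition input_lens :: "network \<Rightarrow> 'a code \<Rightarrow> nat \<Rightarrow> nat list" where
  "input_lens N C v = map (case_sum (msg_len C) (\<lambda>e. edge_len C)) (inputs N v)"

definition input_space :: "network \<Rightarrow> 'a code \<Rightarrow> nat \<Rightarrow> 'a vec list set" where
  "input_space N C v = {vs. map dim_vec vs = input_lens N C v}"

definition is_code :: "network \<Rightarrow> 'a code \<Rightarrow> bool" where
  "is_code N C \<longleftrightarrow>
     edge_len C \<ge> 1 \<and>
     (\<forall>e\<in>arcs (graph N).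
        edge_fun C e \<in> input_space N C (tail (graph N) e) \<rightarrow> carrier_vec (edge_len C)) \<and>
     (\<forall>v\<in>receivers N. \<forall>i\<in>demands N v.
        dec_fun C v i \<in> input_space N C v \<rightarrow> carrier_vec (msg_len C i))"

definition message_values :: "network \<Rightarrow> 'a code \<Rightarrow> (nat \<Rightarrow> 'a vec) set" where
  "message_values N C = {x. \<forall>i<num_msgs N. x i \<in> carrier_vec (msg_len C i)}"

text \<open>
  \<open>c\<close> gives the vector carried by each edge when the messages have values \<open>x\<close>. Acyclicity
  makes \<open>c\<close> exist and be unique on the edges; see \<open>carried_exists\<close> and \<open>carried_unique\<close> below.
\<close>

definition carried :: "network \<Rightarrow> 'a code \<Rightarrow> (nat \<Rightarrow> 'a vec) \<Rightarrow> (nat \<Rightarrow> 'a vec) \<Rightarrow> bool" where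
  "carried N C x c \<longleftrightarrow>
     (\<forall>e\<in>arcs (graph N).
        c e = edge_fun C e (map (case_sum x c) (inputs N (tail (graph N) e))))"

definition is_solution :: "network \<Rightarrow> 'a code \<Rightarrow> bool" where
  "is_solution N C \<longleftrightarrow>
     is_code N C \<and>
     (\<forall>x\<in>message_values N C. \<forall>c. carried N C x c \<longrightarrow>
        (\<forall>v\<in>receivers N. \<forall>i\<in>demands N v.
           dec_fun C v i (map (case_sum x c) (inputs N v)) = x i))"

definition rate_vector :: "network \<Rightarrow> 'a code \<Rightarrow> rat vec" where
  "rate_vector N C = vec (num_msgs N) (\<lambda>i. of_nat (msg_len C i) / of_nat (edge_len C))"

definition concat_vec :: "'a vec list \<Rightarrow> 'a vec" where
  "concat_vec vs = foldr (@\<^sub>v) vs vNil"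

definition linear_map_on :: "network \<Rightarrow> 'a::field code \<Rightarrow> nat \<Rightarrow> nat \<Rightarrow> ('a vec list \<Rightarrow> 'a vec) \<Rightarrow> bool"
  where
  "linear_map_on N C v d f \<longleftrightarrow>
     (\<exists>A\<in>carrier_mat d (sum_list (input_lens N C v)).
        \<forall>vs\<in>input_space N C v. f vs = A *\<^sub>v concat_vec vs)"

definition is_linear :: "network \<Rightarrow> 'a::field code \<Rightarrow> bool" where
  "is_linear N C \<longleftrightarrow>
     (\<forall>e\<in>arcs (graph N). linear_map_on N C (tail (graph N) e) (edge_len C) (edge_fun C e)) \<and>
     (\<forall>v\<in>receivers N. \<forall>i\<in>demands N v. linear_map_on N C v (msg_len C i) (dec_fun C v i))"

definition linearly_achievable :: "'a::{field,finite} itself \<Rightarrow> network \<Rightarrow> rat vec \<Rightarrow> bool" where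
  "linearly_achievable F N r \<longleftrightarrow>
     (\<exists>C :: 'a code. is_solution N C \<and> is_linear N C \<and> rate_vector N C = r)"

definition linear_rate_region :: "'a::{field,finite} itself \<Rightarrow> network \<Rightarrow> rat vec set" where
  "linear_rate_region F N = {r \<in> carrier_vec (num_msgs N). linearly_achievable F N r}"

definition edge_order :: "network \<Rightarrow> (nat \<times> nat) set" where
  "edge_order N = {(e', e). e' \<in> arcs (graph N) \<and> e \<in> arcs (graph N) \<and>
     head (graph N) e' = tail (graph N) e}"

lemma wf_edge_order:
  assumes "is_network N"
  shows "wf (edge_order N)"
proof -
  interpret fin_digraph "graph N" using assms by (simp add: is_network_def)
  have "finite (arcs_ends (graph N))" by (simp add: arcs_ends_def)
  moreover have "acyclic (arcs_ends (graph N))" using assms by (simp add: is_network_def)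
  ultimately have "wf (arcs_ends (graph N))" by (rule finite_acyclic_wf)
  hence "wf (inv_image (arcs_ends (graph N)) (tail (graph N)))" by (rule wf_inv_image)
  moreover have "edge_order N \<subseteq> inv_image (arcs_ends (graph N)) (tail (graph N))"
    by (auto simp: edge_order_def inv_image_def arcs_ends_def arc_to_ends_def)
  ultimately show ?thesis by (rule wf_subset)
qed

lemma set_inputs:
  assumes "is_network N"
  shows "set (inputs N v) =
     Inl ` {i. i < num_msgs N \<and> origin N i = v} \<union> Inr ` in_arcs (graph N) v"
proof -
  interpret fin_digraph "graph N" using assms by (simp add: is_network_def)
  have "finite (in_arcs (graph N) v)"
    by (rule finite_subset[of _ "arcs (graph N)"]) (auto simp: in_arcs_def)
  thus ?thesis by (simp add: inputs_def)
qed

lemma carried_exists: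
  assumes "is_network N"
  shows "\<exists>c. carried N C x c"
proof -
  define H where "H = (\<lambda>f e. edge_fun C e (map (case_sum x f) (inputs N (tail (graph N) e))))"
  define c where "c = wfrec (edge_order N) H"
  have "c e = H c e" if e: "e \<in> arcs (graph N)" for e
  proof -
    have "c e = H (cut c (edge_order N) e) e"
      unfolding c_def by (rule wfrec[OF wf_edge_order[OF assms]])
    also have "\<dots> = H c e"
      unfolding H_def using e
      by (intro arg_cong[of _ _ "edge_fun C e"] map_cong)
         (auto simp: set_inputs[OF assms] cut_def edge_order_def in_arcs_def)
    finally show ?thesis .
  qed
  hence "carried N C x c" by (simp add: carried_def H_def)
  thus ?thesis by blast
qed

lemma carried_unique:
  assumes "is_network N" "carried N C x c" "carried N C x c'" "e \<in> arcs (graph N)"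
  shows "c e = c' e"
  using wf_edge_order[OF assms(1)] assms(4)
proof (induction e)
  case (less e)
  have "map (case_sum x c) (inputs N (tail (graph N) e))
      = map (case_sum x c') (inputs N (tail (graph N) e))"
    using less by (intro map_cong) (auto simp: set_inputs[OF assms(1)] edge_order_def in_arcs_def)
  thus ?case using assms(2,3) less.prems unfolding carried_def by metis
qed

end

theory Submission
  imports Defs
begin

text \<open>
  Let \<open>F\<close> and \<open>K\<close> have the same characteristic, let \<open>b 0, ..., b (a - 1)\<close> be a basis of \<open>F\<close> over
  the prime field and let \<open>f\<close> in \<open>F\<close> act on \<open>K^a\<close> by the matrix of multiplication by \<open>f\<close>. Replacing
  every matrix entry of a code over \<open>F\<close> by such a block gives a code over \<open>K\<close> whose block
  sizes are all multiplied by \<open>a\<close>. It decodes because the \<open>F\<close>-linear maps \<open>K^a \<rightarrow> F\<close> separate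
  points and, applied blockwise, send what the new code carries to what the old code carries.

  Conversely, for \<open>m = CHAR(F)\<close> there is a network whose coding at rate 1 amounts to recovering
  \<open>x 0, ..., x m\<close> from the sums \<open>\<Sum>j\<noteq>i. x j\<close> (\<open>i \<le> m\<close>). These sums add up to \<open>m\<close> times the
  sum of all \<open>x j\<close>, so this is possible precisely when \<open>m\<close> is nonzero in the field.
\<close>

section \<open>Extension of scalars\<close>

lemma additive_sum:
  fixes f :: "'a::comm_monoid_add \<Rightarrow> 'b::comm_monoid_add"
  assumes "f 0 = 0" "\<And>x y. f (x + y) = f x + f y"
  shows "f (sum g A) = (\<Sum>i\<in>A. f (g i))"
  using assms by (induction A rule: infinite_finite_induct) auto

text \<open>Prime-field elements are represented by integers under \<open>of_int\<close>, so that
  one scalar can be read in two fields. For such scalars additivity already implies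
  linearity.\<close>

lemma additive_of_int:
  fixes f :: "'a::ring_1 \<Rightarrow> 'b::ring_1"
  assumes add: "\<And>x y. f (x + y) = f x + f y"
  shows "f (of_int m * x) = of_int m * f x"
proof -
  have z: "f 0 = 0" using add[of 0 0] by simp
  have u: "f (- y) = - f y" for y using add[of y "- y"] z by (simp add: eq_neg_iff_add_eq_0 add.commute)
  have n: "f (of_nat k * x) = of_nat k * f x" for k
    by (induction k) (simp_all add: z add algebra_simps)
  show ?thesis
  proof (cases m)
    case (nonneg k)
    then show ?thesis using n by simp
  next
    case (neg k)
    hence "of_int m * x = - (of_nat (Suc k) * x)" "of_int m * f x = - (of_nat (Suc k) * f x)"
      by (simp_all only: neg of_int_minus of_int_of_nat_eq mult_minus_left)
    then show ?thesis using n[of "Suc k"] u[of "of_nat (Suc k) * x"] by (simp only:)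
  qed
qed

text \<open>The characteristic is prime and does not divide \<open>c\<close>, so a Bezout identity
  inverts \<open>c\<close> modulo it.\<close>

lemma inverse_of_int_finite_field:
  fixes c :: int
  assumes "of_int c \<noteq> (0 :: 'a::{field,finite})"
  obtains d where "of_int d * of_int c = (1 :: 'a)"
proof -
  have "CHAR('a) > 0" by (rule finite_imp_CHAR_pos) simp
  hence p: "prime (int CHAR('a))" using prime_CHAR_semidom by simp
  have "\<not> int CHAR('a) dvd c" using assms by (simp add: of_int_eq_0_iff_char_dvd)
  hence "coprime (int CHAR('a)) c" using p by (rule prime_imp_coprime[rotated])
  then obtain u v where "u * int CHAR('a) + v * c = 1" using bezout_int[of "int CHAR('a)" c] by auto
  hence "of_int (u * int CHAR('a) + v * c) = (1 :: 'a)" by simp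
  hence "of_int v * of_int c = (1 :: 'a)" by simp
  thus ?thesis by (rule that)
qed

section \<open>Bases and coordinates over the prime field\<close>

text \<open>Integer coefficients are determined only modulo the characteristic; hence independence
  asks for \<open>of_int (c i) = 0\<close> instead of \<open>c i = 0\<close>.\<close>

definition prime_field_basis :: "nat \<Rightarrow> (nat \<Rightarrow> 'a::ring_1) \<Rightarrow> bool" where
  "prime_field_basis n b \<longleftrightarrow>
     (\<forall>y. \<exists>c :: nat \<Rightarrow> int. y = (\<Sum>i<n. of_int (c i) * b i)) \<and>
     (\<forall>c :: nat \<Rightarrow> int. (\<Sum>i<n. of_int (c i) * b i) = 0 \<longrightarrow> (\<forall>i<n. of_int (c i) = (0 :: 'a)))"

text \<open>A spanning set of least cardinality is independent: a relation with a nonzero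
  coefficient at \<open>z\<close> could be solved for \<open>z\<close>, and the rest would still
  span.\<close>

lemma prime_field_basis_exists:
  obtains n and b :: "nat \<Rightarrow> 'a::{field,finite}" where "prime_field_basis n b"
proof -
  define spans where
    "spans B \<longleftrightarrow> (\<forall>y. \<exists>c :: 'a \<Rightarrow> int. y = (\<Sum>x\<in>B. of_int (c x) * x))" for B :: "'a set"
  have "spans UNIV" unfolding spans_def
  proof
    fix y :: 'a
    have "(\<Sum>x\<in>UNIV. of_int (if x = y then 1 else 0) * x) = (\<Sum>x\<in>UNIV. if x = y then x else 0)"
      by (rule sum.cong) auto
    hence "y = (\<Sum>x\<in>UNIV. of_int (if x = y then 1 else 0) * x)" by simp
    thus "\<exists>c. y = (\<Sum>x\<in>UNIV. of_int (c x) * x)"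
      by (intro exI[of _ "\<lambda>x. if x = y then 1 else 0"])
  qed
  then obtain B where B: "spans B" and min: "\<And>B'. spans B' \<Longrightarrow> card B \<le> card B'"
    using ex_has_least_nat[of spans UNIV card] by blast
  have indep: "of_int (c z) = (0 :: 'a)"
    if c: "(\<Sum>x\<in>B. of_int (c x) * x) = 0" and z: "z \<in> B" for c z
  proof (rule ccontr)
    assume "of_int (c z) \<noteq> (0 :: 'a)"
    then obtain d where d: "of_int d * of_int (c z) = (1 :: 'a)"
      by (rule inverse_of_int_finite_field)
    have "of_int (c z) * z + (\<Sum>x\<in>B - {z}. of_int (c x) * x) = 0"
      using c z by (simp add: sum.remove)
    hence "of_int d * (of_int (c z) * z + (\<Sum>x\<in>B - {z}. of_int (c x) * x)) = 0" by simp
    hence "of_int d * of_int (c z) * z + (\<Sum>x\<in>B - {z}. of_int (d * c x) * x) = 0"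
      by (simp add: distrib_left sum_distrib_left mult.assoc)
    hence zz: "z = - (\<Sum>x\<in>B - {z}. of_int (d * c x) * x)"
      by (simp only: d mult_1 eq_neg_iff_add_eq_0)
    have "spans (B - {z})" unfolding spans_def
    proof
      fix y
      obtain e :: "'a \<Rightarrow> int" where "y = (\<Sum>x\<in>B. of_int (e x) * x)" using B spans_def by blast
      also have "\<dots> = of_int (e z) * z + (\<Sum>x\<in>B - {z}. of_int (e x) * x)"
        using z by (simp add: sum.remove)
      also have "of_int (e z) * z = - (\<Sum>x\<in>B - {z}. of_int (e z * d * c x) * x)"
        by (subst zz) (simp add: sum_distrib_left mult.assoc)
      also have "\<dots> + (\<Sum>x\<in>B - {z}. of_int (e x) * x)
          = (\<Sum>x\<in>B - {z}. of_int (e x - e z * d * c x) * x)"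
        by (simp add: sum_negf[symmetric] sum.distrib[symmetric] algebra_simps)
      finally show "\<exists>c :: 'a \<Rightarrow> int. y = (\<Sum>x\<in>B - {z}. of_int (c x) * x)" 
        by (intro exI[of _ "\<lambda>x. e x - e z * d * c x"])
    qed
    hence "card B \<le> card (B - {z})" by (rule min)
    thus False using z by (metis card_Diff1_less finite_class.finite not_less)
  qed
  obtain b where b: "bij_betw b {..<card B} B"
    using ex_bij_betw_nat_finite[of B] by (auto simp: atLeast0LessThan)
  have re: "(\<Sum>i<card B. of_int (c (b i)) * b i) = (\<Sum>x\<in>B. of_int (c x) * x)" for c :: "'a \<Rightarrow> int"
    using sum.reindex_bij_betw[OF b, of "\<lambda>x. of_int (c x) * x"] .
  have "prime_field_basis (card B) b" unfolding prime_field_basis_def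
  proof (intro conjI allI impI)
    fix y
    obtain c :: "'a \<Rightarrow> int" where "y = (\<Sum>x\<in>B. of_int (c x) * x)" using B spans_def by blast
    thus "\<exists>c :: nat \<Rightarrow> int. y = (\<Sum>i<card B. of_int (c i) * b i)" using re[of c] by metis
  next
    fix c :: "nat \<Rightarrow> int" and i
    assume c: "(\<Sum>i<card B. of_int (c i) * b i) = 0" and i: "i < card B"
    \<comment> \<open>Coefficients indexed by numbers are pulled back to \<open>B\<close>, where
      independence is known.\<close>
    define c' where "c' x = c (inv_into {..<card B} b x)" for x
    have c': "c' (b i) = c i" if "i < card B" for i
      using b that unfolding c'_def by (simp add: bij_betw_inv_into_left)
    have "(\<Sum>i<card B. of_int (c' (b i)) * b i) = (\<Sum>i<card B. of_int (c i) * b i)"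
      by (rule sum.cong) (simp_all add: c')
    with c re[of c'] have "(\<Sum>x\<in>B. of_int (c' x) * x) = 0" by simp
    moreover have "b i \<in> B" using b i by (auto simp: bij_betw_def)
    ultimately show "of_int (c i) = (0 :: 'a)" using indep[of c' "b i"] c'[OF i] by simp
  qed
  thus ?thesis by (rule that)
qed

text \<open>Take integer coordinates of \<open>y\<close> over the prime field of \<open>'k\<close>
  and read them in \<open>'f\<close>. An integer vanishes in both fields or in neither, so the
  relations between coordinates survive this change of field.\<close>

lemma prime_field_coordinates:
  assumes ch: "CHAR('f::{field,finite}) = CHAR('k::{field,finite})"
  obtains \<kappa> :: "nat \<Rightarrow> 'k::{field,finite} \<Rightarrow> int"
  where "\<And>j x y. of_int (\<kappa> j (x + y)) = (of_int (\<kappa> j x) + of_int (\<kappa> j y) :: 'f)"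
    and "\<And>y. (\<And>j. of_int (\<kappa> j y) = (0 :: 'f)) \<Longrightarrow> y = 0"
proof -
  obtain n and d :: "nat \<Rightarrow> 'k" where "prime_field_basis n d" by (rule prime_field_basis_exists)
  hence sp: "\<forall>y. \<exists>c :: nat \<Rightarrow> int. y = (\<Sum>i<n. of_int (c i) * d i)"
    and ind: "\<And>c :: nat \<Rightarrow> int. (\<Sum>i<n. of_int (c i) * d i) = 0 \<Longrightarrow> \<forall>i<n. of_int (c i) = (0 :: 'k)"
    by (auto simp: prime_field_basis_def)
  obtain c0 :: "'k \<Rightarrow> nat \<Rightarrow> int" where c0: "\<And>y. y = (\<Sum>i<n. of_int (c0 y i) * d i)"
    using sp by metis
  have tr: "of_int z = (0 :: 'f) \<longleftrightarrow> of_int z = (0 :: 'k)" for z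
    by (simp add: of_int_eq_0_iff_char_dvd ch)
  \<comment> \<open>Padding with zeros lets \<open>j\<close> range over all naturals.\<close>
  define \<kappa> where "\<kappa> j y = (if j < n then c0 y j else 0)" for j y
  show ?thesis
  proof (rule that[of \<kappa>])
    fix j x y
    \<comment> \<open>The chosen integers need not be additive; their defect is a family of
      coefficients of the zero element, so it vanishes in \<open>'k\<close> and hence in
      \<open>'f\<close>.\<close>
    have "(\<Sum>i<n. of_int (c0 (x + y) i - c0 x i - c0 y i) * d i)
        = (\<Sum>i<n. of_int (c0 (x + y) i) * d i) - (\<Sum>i<n. of_int (c0 x i) * d i)
          - (\<Sum>i<n. of_int (c0 y i) * d i)"
      by (simp add: sum_subtractf sum.distrib algebra_simps)
    also have "\<dots> = 0" by (simp add: c0[symmetric])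
    finally have "\<forall>i<n. of_int (c0 (x + y) i - c0 x i - c0 y i) = (0 :: 'k)" by (rule ind)
    hence "\<forall>i<n. of_int (c0 (x + y) i - c0 x i - c0 y i) = (0 :: 'f)" by (simp only: tr)
    thus "of_int (\<kappa> j (x + y)) = (of_int (\<kappa> j x) + of_int (\<kappa> j y) :: 'f)"
      by (auto simp: \<kappa>_def algebra_simps)
  next
    fix y
    assume a: "\<And>j. of_int (\<kappa> j y) = (0 :: 'f)"
    have "of_int (c0 y i) = (0 :: 'k)" if "i < n" for i using a[of i] that by (simp add: \<kappa>_def tr)
    hence "(\<Sum>i<n. of_int (c0 y i) * d i) = 0" by simp
    thus "y = 0" using c0[of y] by simp
  qed
qed

text \<open>
  \<open>l\<close> plays an \<open>F\<close>-linear functional on \<open>K^a\<close>, where \<open>f\<close> acts by the matrix \<open>\<rho> f\<close>. Vectors are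
  functions of which only the values below \<open>a\<close> matter.
\<close>

locale block_functional =
  fixes a :: nat and \<rho> :: "'f::field \<Rightarrow> nat \<Rightarrow> nat \<Rightarrow> 'k::field" and l :: "(nat \<Rightarrow> 'k) \<Rightarrow> 'f"
  assumes pos: "a > 0"
    and cong: "\<And>v w. (\<And>s. s < a \<Longrightarrow> v s = w s) \<Longrightarrow> l v = l w"
    and add: "\<And>v w. l (\<lambda>s. v s + w s) = l v + l w"
    and action: "\<And>f v. l (\<lambda>s. \<Sum>t<a. \<rho> f s t * v t) = f * l v"

text \<open>The functional \<open>l j\<close> takes the \<open>j\<close>-th coordinate of every
  entry of a vector over \<open>'k\<close> and uses the results as coefficients in a basis of
  \<open>'f\<close>. The entries of \<rho> come from integers, so linearity of the coordinates over
  the prime field is enough for compatibility with multiplication in \<open>'f\<close>.\<close>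

lemma block_functionals_exist:
  assumes ch: "CHAR('f::{field,finite}) = CHAR('k::{field,finite})"
  obtains a and \<rho> :: "'f::{field,finite} \<Rightarrow> nat \<Rightarrow> nat \<Rightarrow> 'k::{field,finite}" and l :: "nat \<Rightarrow> (nat \<Rightarrow> 'k) \<Rightarrow> 'f"
  where "\<forall>j. block_functional a \<rho> (l j)"
    and "\<forall>v. (\<forall>j. l j v = 0) \<longrightarrow> (\<forall>s<a. v s = 0)"
proof -
  obtain a and b :: "nat \<Rightarrow> 'f" where "prime_field_basis a b" by (rule prime_field_basis_exists)
  hence sp: "\<forall>y. \<exists>c :: nat \<Rightarrow> int. y = (\<Sum>i<a. of_int (c i) * b i)"
    and ind: "\<And>c :: nat \<Rightarrow> int. (\<Sum>i<a. of_int (c i) * b i) = 0 \<Longrightarrow> \<forall>i<a. of_int (c i) = (0 :: 'f)"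
    by (auto simp: prime_field_basis_def)
  obtain \<kappa> :: "nat \<Rightarrow> 'k \<Rightarrow> int"
    where kadd: "\<And>j x y. of_int (\<kappa> j (x + y)) = (of_int (\<kappa> j x) + of_int (\<kappa> j y) :: 'f)"
      and ksep: "\<And>y. (\<And>j. of_int (\<kappa> j y) = (0 :: 'f)) \<Longrightarrow> y = 0"
    using prime_field_coordinates[OF ch] by metis
  have "\<forall>f t. \<exists>c :: nat \<Rightarrow> int. f * b t = (\<Sum>i<a. of_int (c i) * b i)" using sp by blast
  then obtain \<mu> :: "'f \<Rightarrow> nat \<Rightarrow> nat \<Rightarrow> int"
    where \<mu>: "\<And>f t. f * b t = (\<Sum>s<a. of_int (\<mu> f t s) * b s)" by metis
  \<comment> \<open>Column \<open>t\<close> holds the coordinates of \<open>f * b t\<close>, read in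
    \<open>'k\<close>.\<close>
  define \<rho> :: "'f \<Rightarrow> nat \<Rightarrow> nat \<Rightarrow> 'k" where "\<rho> f s t = of_int (\<mu> f t s)" for f s t
  define l where "l j v = (\<Sum>s<a. of_int (\<kappa> j (v s)) * b s)" for j and v :: "nat \<Rightarrow> 'k"
  have a: "a > 0" 
  proof (rule ccontr)
    assume "\<not> a > 0"
    hence "(1 :: 'f) = 0" using sp by simp
    thus False by simp
  qed
  have k0: "of_int (\<kappa> j 0) = (0 :: 'f)" for j using kadd[of j 0 0] by (simp only: add_0 add_cancel_right_right)
  have kmul: "of_int (\<kappa> j (of_int m * y)) = (of_int m * of_int (\<kappa> j y) :: 'f)" for j m y
    by (rule additive_of_int) (rule kadd)
  have ksum: "of_int (\<kappa> j (sum g A)) = (\<Sum>i\<in>A. of_int (\<kappa> j (g i)) :: 'f)" for j A and g :: "nat \<Rightarrow> 'k"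
    by (rule additive_sum[where f = "\<lambda>y. of_int (\<kappa> j y)"]) (simp_all add: k0 kadd)
  have "block_functional a \<rho> (l j)" for j
  proof
    show "a > 0" by (rule a)
    show "l j v = l j w" if "\<And>s. s < a \<Longrightarrow> v s = w s" for v w
      unfolding l_def by (rule sum.cong) (simp_all add: that)
    show "l j (\<lambda>s. v s + w s) = l j v + l j w" for v w
      by (simp add: l_def kadd distrib_right sum.distrib)
    show "l j (\<lambda>s. \<Sum>t<a. \<rho> f s t * v t) = f * l j v" for f v
    proof -
      have "l j (\<lambda>s. \<Sum>t<a. \<rho> f s t * v t)
          = (\<Sum>s<a. \<Sum>t<a. of_int (\<mu> f t s) * of_int (\<kappa> j (v t)) * b s)"
        by (simp add: l_def \<rho>_def ksum kmul sum_distrib_right)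
      also have "\<dots> = (\<Sum>t<a. of_int (\<kappa> j (v t)) * (\<Sum>s<a. of_int (\<mu> f t s) * b s))"
        by (subst sum.swap) (simp add: sum_distrib_left algebra_simps)
      also have "\<dots> = (\<Sum>t<a. of_int (\<kappa> j (v t)) * (f * b t))"
        by (simp only: \<mu>[symmetric])
      also have "\<dots> = f * l j v"
        by (simp add: l_def sum_distrib_left algebra_simps)
      finally show ?thesis .
    qed
  qed
  \<comment> \<open>Independence of \<open>b\<close> turns the vanishing of \<open>l j v\<close>
    into the vanishing of the \<open>j\<close>-th coordinate of each entry.\<close>
  moreover have "v s = 0" if "\<And>j. l j v = 0" "s < a" for v s
  proof (rule ksep)
    fix j
    have "(\<Sum>s<a. of_int (\<kappa> j (v s)) * b s) = 0" using that(1)[of j] by (simp add: l_def)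
    hence "\<forall>s<a. of_int (\<kappa> j (v s)) = (0 :: 'f)" by (rule ind[of "\<lambda>s. \<kappa> j (v s)"])
    thus "of_int (\<kappa> j (v s)) = (0 :: 'f)" using that(2) by simp
  qed
  ultimately show ?thesis using that[of a \<rho> l] by metis
qed

section \<open>Blockwise matrices and vectors\<close>

context block_functional
begin

lemma zero: "l (\<lambda>s. 0) = 0"
  using add[of "\<lambda>s. 0" "\<lambda>s. 0"] by (simp only: add_0 add_cancel_right_right)

lemma sum: "l (\<lambda>s. \<Sum>i\<in>A. g i s) = (\<Sum>i\<in>A. l (g i))"
  by (induction A rule: infinite_finite_induct) (simp_all add: zero add)

definition blow_up :: "'f mat \<Rightarrow> 'k mat" where
  "blow_up A = mat (dim_row A * a) (dim_col A * a)
     (\<lambda>(r, t). \<rho> (A $$ (r div a, t div a)) (r mod a) (t mod a))"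

text \<open>The comparison map from vectors over \<open>'k\<close> in the new code to vectors over
  \<open>'f\<close> in the old one.\<close>

definition fold_vec :: "'k vec \<Rightarrow> 'f vec" where
  "fold_vec w = vec (dim_vec w div a) (\<lambda>r. l (\<lambda>s. w $ (r * a + s)))"

lemma block_index:
  fixes r n s :: nat
  assumes "r < n" "s < a"
  shows "r * a + s < n * a"
proof -
  have "r * a + s < Suc r * a" using assms by simp
  also have "\<dots> \<le> n * a" using assms by (intro mult_le_mono1) simp
  finally show ?thesis .
qed

text \<open>\<open>v\<close> has to end at a block boundary, or a block could straddle the two
  parts; an incomplete last block of \<open>w\<close> is dropped on both sides.\<close>

lemma fold_vec_append:
  assumes v: "dim_vec v = m * a"
  shows "fold_vec (v @\<^sub>v w) = fold_vec v @\<^sub>v fold_vec w"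
proof (rule eq_vecI)
  show "dim_vec (fold_vec (v @\<^sub>v w)) = dim_vec (fold_vec v @\<^sub>v fold_vec w)"
    using pos v by (simp add: fold_vec_def)
  fix r assume "r < dim_vec (fold_vec v @\<^sub>v fold_vec w)"
  hence r: "r < m + dim_vec w div a" using pos v by (simp add: fold_vec_def)
  show "fold_vec (v @\<^sub>v w) $ r = (fold_vec v @\<^sub>v fold_vec w) $ r"
  proof (cases "r < m")
    case True
    have "l (\<lambda>s. (v @\<^sub>v w) $ (r * a + s)) = l (\<lambda>s. v $ (r * a + s))"
      using True block_index[OF True] v by (intro cong) (simp add: trans_less_add1)
    thus ?thesis using True r v pos by (simp add: fold_vec_def)
  next
    case False
    define q where "q = r - m"
    have q: "r = m + q" "q < dim_vec w div a" using False r by (auto simp: q_def)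
    have "q * a + s < dim_vec w" if "s < a" for s
      using block_index[OF q(2) that] div_times_less_eq_dividend[of "dim_vec w" a]
      by (rule less_le_trans)
    hence "l (\<lambda>s. (v @\<^sub>v w) $ (r * a + s)) = l (\<lambda>s. w $ (q * a + s))"
      using v by (intro cong) (auto simp: q(1) algebra_simps)
    thus ?thesis using q v pos by (simp add: fold_vec_def)
  qed
qed

lemma fold_vec_concat_vec:
  assumes "\<And>v. v \<in> set vs \<Longrightarrow> a dvd dim_vec v"
  shows "fold_vec (concat_vec vs) = concat_vec (map fold_vec vs)"
  using assms
proof (induction vs)
  case Nil
  show ?case by (rule eq_vecI) (simp_all add: concat_vec_def fold_vec_def)
next
  case (Cons v vs)
  then obtain m where "dim_vec v = m * a" by (metis dvd_def list.set_intros(1) mult.commute)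
  hence "fold_vec (v @\<^sub>v concat_vec vs) = fold_vec v @\<^sub>v fold_vec (concat_vec vs)"
    by (rule fold_vec_append)
  with Cons show ?case by (simp add: concat_vec_def)
qed

text \<open>Grouping the columns exhibits each block of the product as a sum of blocks of
  \<open>w\<close> acted on by \<rho>; \<open>l\<close> is additive and turns each such action into
  multiplication by the matrix entry.\<close>

lemma fold_vec_blow_up:
  assumes w: "dim_vec w = dim_col A * a"
  shows "fold_vec (blow_up A *\<^sub>v w) = A *\<^sub>v fold_vec w"
proof (rule eq_vecI)
  show "dim_vec (fold_vec (blow_up A *\<^sub>v w)) = dim_vec (A *\<^sub>v fold_vec w)"
    using pos by (simp add: fold_vec_def blow_up_def)
  fix r assume "r < dim_vec (A *\<^sub>v fold_vec w)"
  hence r: "r < dim_row A" by simp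
  have "(blow_up A *\<^sub>v w) $ (r * a + s)
      = (\<Sum>q<dim_col A. \<Sum>t<a. \<rho> (A $$ (r, q)) s t * w $ (q * a + t))" if s: "s < a" for s
  proof -
    have "(blow_up A *\<^sub>v w) $ (r * a + s)
        = (\<Sum>j<dim_col A * a. \<rho> (A $$ (r, j div a)) s (j mod a) * w $ j)"
      using block_index[OF r s] s w
      by (simp add: blow_up_def scalar_prod_def atLeast0LessThan)
    also have "\<dots> = (\<Sum>q<dim_col A. \<Sum>j\<in>{q * a..<q * a + a}. \<rho> (A $$ (r, j div a)) s (j mod a) * w $ j)"
      by (rule sum.nat_group[symmetric])
    also have "\<dots> = (\<Sum>q<dim_col A. \<Sum>t<a. \<rho> (A $$ (r, q)) s t * w $ (q * a + t))"
    proof (rule sum.cong)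
      fix q
      have "(\<Sum>j\<in>{q * a..<q * a + a}. \<rho> (A $$ (r, j div a)) s (j mod a) * w $ j)
          = (\<Sum>j\<in>{0 + q * a..<a + q * a}. \<rho> (A $$ (r, j div a)) s (j mod a) * w $ j)"
        by (simp add: add.commute)
      also have "\<dots> = (\<Sum>t\<in>{0..<a}. \<rho> (A $$ (r, (t + q * a) div a)) s ((t + q * a) mod a) * w $ (t + q * a))"
        by (rule sum.shift_bounds_nat_ivl)
      also have "\<dots> = (\<Sum>t<a. \<rho> (A $$ (r, q)) s t * w $ (q * a + t))"
        by (rule sum.cong) (simp_all add: atLeast0LessThan add.commute)
      finally show "(\<Sum>j\<in>{q * a..<q * a + a}. \<rho> (A $$ (r, j div a)) s (j mod a) * w $ j)
          = (\<Sum>t<a. \<rho> (A $$ (r, q)) s t * w $ (q * a + t))" .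
    qed simp
    finally show ?thesis .
  qed
  hence "l (\<lambda>s. (blow_up A *\<^sub>v w) $ (r * a + s))
      = l (\<lambda>s. \<Sum>q<dim_col A. \<Sum>t<a. \<rho> (A $$ (r, q)) s t * w $ (q * a + t))"
    by (rule cong)
  also have "\<dots> = (\<Sum>q<dim_col A. l (\<lambda>s. \<Sum>t<a. \<rho> (A $$ (r, q)) s t * w $ (q * a + t)))"
    by (rule sum)
  also have "\<dots> = (\<Sum>q<dim_col A. A $$ (r, q) * l (\<lambda>t. w $ (q * a + t)))"
    by (simp only: action)
  also have "\<dots> = (A *\<^sub>v fold_vec w) $ r"
    using r w pos by (simp add: scalar_prod_def fold_vec_def atLeast0LessThan)
  finally show "fold_vec (blow_up A *\<^sub>v w) $ r = (A *\<^sub>v fold_vec w) $ r"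
    using r pos by (simp add: fold_vec_def blow_up_def)
qed

end

section \<open>Linear codes as matrices\<close>

lemma dim_concat_vec: "dim_vec (concat_vec vs) = sum_list (map dim_vec vs)"
  by (induction vs) (simp_all add: concat_vec_def)

lemma concat_vec_map_add:
  assumes "\<And>s. s \<in> set xs \<Longrightarrow> dim_vec (f s) = dim_vec (g s)"
  shows "concat_vec (map (\<lambda>s. f s + g s) xs) = concat_vec (map f xs) + concat_vec (map g xs)"
  using assms
proof (induction xs)
  case Nil
  show ?case by (rule eq_vecI) (simp_all add: concat_vec_def)
next
  case (Cons x xs)
  let ?n = "dim_vec (g x)" and ?m = "sum_list (map (\<lambda>s. dim_vec (g s)) xs)"
  have m: "map (\<lambda>s. dim_vec (f s)) xs = map (\<lambda>s. dim_vec (g s)) xs" using Cons.prems by simp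
  have "f x \<in> carrier_vec ?n" "g x \<in> carrier_vec ?n"
    "concat_vec (map f xs) \<in> carrier_vec ?m" "concat_vec (map g xs) \<in> carrier_vec ?m"
    using Cons.prems by (auto intro!: carrier_vecI simp: dim_concat_vec comp_def m)
  note app = append_vec_add[OF this]
  have "concat_vec (map (\<lambda>s. f s + g s) xs) = concat_vec (map f xs) + concat_vec (map g xs)"
    using Cons by simp
  hence "concat_vec (map (\<lambda>s. f s + g s) (x # xs))
      = (f x + g x) @\<^sub>v (concat_vec (map f xs) + concat_vec (map g xs))"
    by (simp add: concat_vec_def)
  also note app[symmetric]
  finally show ?case by (simp add: concat_vec_def)
qed

text \<open>Induction along \<open>edge_order\<close>: the inputs of an edge are messages, whose
  lengths are given, and vectors on earlier edges.\<close>

lemma carried_in_carrier: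
  assumes N: "is_network N" and C: "is_code N C" and x: "x \<in> message_values N C"
    and c: "carried N C x c"
  shows "e \<in> arcs (graph N) \<Longrightarrow> c e \<in> carrier_vec (edge_len C)"
    and "map (case_sum x c) (inputs N v) \<in> input_space N C v"
proof -
  have inp: "map (case_sum x c) (inputs N v) \<in> input_space N C v"
    if "\<And>e. e \<in> in_arcs (graph N) v \<Longrightarrow> c e \<in> carrier_vec (edge_len C)" for v
    using that x by (auto simp: input_space_def input_lens_def set_inputs[OF N] message_values_def)
  have all: "c e \<in> carrier_vec (edge_len C)" if "e \<in> arcs (graph N)" for e
    using wf_edge_order[OF N] that
  proof (induction e)
    case (less e)
    have "map (case_sum x c) (inputs N (tail (graph N) e)) \<in> input_space N C (tail (graph N) e)"
      using less by (intro inp) (auto simp: edge_order_def in_arcs_def)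
    moreover have "c e = edge_fun C e (map (case_sum x c) (inputs N (tail (graph N) e)))"
      using c less.prems by (auto simp: carried_def)
    ultimately show ?case using C less.prems by (auto simp: is_code_def)
  qed
  show "e \<in> arcs (graph N) \<Longrightarrow> c e \<in> carrier_vec (edge_len C)" by (rule all)
  show "map (case_sum x c) (inputs N v) \<in> input_space N C v"
    by (rule inp) (auto intro: all simp: in_arcs_def)
qed

definition matrix_code ::
  "(nat \<Rightarrow> nat) \<Rightarrow> nat \<Rightarrow> (nat \<Rightarrow> 'a mat) \<Rightarrow> (nat \<Rightarrow> nat \<Rightarrow> 'a mat) \<Rightarrow> 'a::field code" where
  "matrix_code k n M D =
     \<lparr>msg_len = k, edge_len = n, edge_fun = \<lambda>e vs. M e *\<^sub>v concat_vec vs,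
      dec_fun = \<lambda>v i vs. D v i *\<^sub>v concat_vec vs\<rparr>"

lemma matrix_code_sel [simp]:
  "msg_len (matrix_code k n M D) = k" "edge_len (matrix_code k n M D) = n"
  "edge_fun (matrix_code k n M D) e vs = M e *\<^sub>v concat_vec vs"
  "dec_fun (matrix_code k n M D) v i vs = D v i *\<^sub>v concat_vec vs"
  by (simp_all add: matrix_code_def)

lemma matrix_code_linear:
  assumes "n \<ge> 1"
    and "\<And>e. e \<in> arcs (graph N) \<Longrightarrow>
      M e \<in> carrier_mat n (sum_list (input_lens N (matrix_code k n M D) (tail (graph N) e)))"
    and "\<And>v i. v \<in> receivers N \<Longrightarrow> i \<in> demands N v \<Longrightarrow>
      D v i \<in> carrier_mat (k i) (sum_list (input_lens N (matrix_code k n M D) v))"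
  shows "is_code N (matrix_code k n M D)" "is_linear N (matrix_code k n M D)"
proof -
  show "is_code N (matrix_code k n M D)"
    unfolding is_code_def
  proof (intro conjI ballI funcsetI)
    show "edge_len (matrix_code k n M D) \<ge> 1" using assms(1) by simp
  next
    fix e vs assume "e \<in> arcs (graph N)"
    from assms(2)[OF this] show "edge_fun (matrix_code k n M D) e vs \<in> carrier_vec (edge_len (matrix_code k n M D))"
      by (intro carrier_vecI) simp
  next
    fix v i vs assume "v \<in> receivers N" "i \<in> demands N v"
    from assms(3)[OF this] show "dec_fun (matrix_code k n M D) v i vs \<in> carrier_vec (msg_len (matrix_code k n M D) i)"
      by (intro carrier_vecI) simp
  qed
  show "is_linear N (matrix_code k n M D)"
    unfolding is_linear_def linear_map_on_def
  proof (intro conjI ballI)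
    fix e assume "e \<in> arcs (graph N)"
    from assms(2)[OF this]
    show "\<exists>A\<in>carrier_mat (edge_len (matrix_code k n M D))
        (sum_list (input_lens N (matrix_code k n M D) (tail (graph N) e))).
        \<forall>vs\<in>input_space N (matrix_code k n M D) (tail (graph N) e).
          edge_fun (matrix_code k n M D) e vs = A *\<^sub>v concat_vec vs"
      by (intro bexI[of _ "M e"]) simp_all
  next
    fix v i assume "v \<in> receivers N" "i \<in> demands N v"
    from assms(3)[OF this]
    show "\<exists>A\<in>carrier_mat (msg_len (matrix_code k n M D) i)
        (sum_list (input_lens N (matrix_code k n M D) v)).
        \<forall>vs\<in>input_space N (matrix_code k n M D) v.
          dec_fun (matrix_code k n M D) v i vs = A *\<^sub>v concat_vec vs"
      by (intro bexI[of _ "D v i"]) simp_all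
  qed
qed

text \<open>Choice fixes one matrix for each edge and each decoder, so that all of them can be
  replaced at once.\<close>

lemma is_linearE:
  assumes "is_linear N C"
  obtains M D
  where "\<forall>e\<in>arcs (graph N).
      M e \<in> carrier_mat (edge_len C) (sum_list (input_lens N C (tail (graph N) e))) \<and>
      (\<forall>vs\<in>input_space N C (tail (graph N) e). edge_fun C e vs = M e *\<^sub>v concat_vec vs)"
    and "\<forall>v\<in>receivers N. \<forall>i\<in>demands N v.
      D v i \<in> carrier_mat (msg_len C i) (sum_list (input_lens N C v)) \<and>
      (\<forall>vs\<in>input_space N C v. dec_fun C v i vs = D v i *\<^sub>v concat_vec vs)"
proof -
  define P where "P v d f A \<longleftrightarrow> A \<in> carrier_mat d (sum_list (input_lens N C v)) \<and>
      (\<forall>vs\<in>input_space N C v. f vs = A *\<^sub>v concat_vec vs)" for v d f and A :: "'a mat"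
  have P: "linear_map_on N C v d f \<longleftrightarrow> (\<exists>A. P v d f A)" for v d f
    by (auto simp: linear_map_on_def P_def)
  define M where "M e = (SOME A. P (tail (graph N) e) (edge_len C) (edge_fun C e) A)" for e
  define D where "D v i = (SOME A. P v (msg_len C i) (dec_fun C v i) A)" for v i
  have M: "P (tail (graph N) e) (edge_len C) (edge_fun C e) (M e)" if "e \<in> arcs (graph N)" for e
    unfolding M_def by (rule someI_ex) (use assms that P in \<open>simp add: is_linear_def\<close>)
  have D: "P v (msg_len C i) (dec_fun C v i) (D v i)" if "v \<in> receivers N" "i \<in> demands N v" for v i
    unfolding D_def by (rule someI_ex) (use assms that P in \<open>simp add: is_linear_def\<close>)
  show ?thesis by (rule that[of M D]) (use M D in \<open>auto simp: P_def\<close>)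
qed

section \<open>Transfer between fields of equal characteristic\<close>

text \<open>Equality of all folds says that every functional vanishes on the difference of
  corresponding blocks, and the functionals are jointly faithful on a block.\<close>

lemma block_functional_separates:
  assumes L: "\<And>j. block_functional a \<rho> (l j)"
    and sep: "\<forall>v. (\<forall>j. l j v = 0) \<longrightarrow> (\<forall>s<a. v s = 0)"
    and u: "u \<in> carrier_vec (n * a)" and w: "w \<in> carrier_vec (n * a)"
    and eq: "\<And>j. block_functional.fold_vec a (l j) u = block_functional.fold_vec a (l j) w"
  shows "u = w"
proof (rule eq_vecI)
  interpret B: block_functional a \<rho> "l j" for j by (rule L)
  fix t assume "t < dim_vec w"
  hence t: "t < n * a" using w by simp
  define r where "r = t div a"
  have r: "r < n" using t B.pos by (simp add: r_def less_mult_imp_div_less)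
  have "l j (\<lambda>s. u $ (r * a + s) - w $ (r * a + s)) = 0" for j
  proof -
    have "l j (\<lambda>s. u $ (r * a + s)) = l j (\<lambda>s. w $ (r * a + s))"
      using arg_cong[OF eq[of j], of "\<lambda>v. vec_index v r"] r u w B.pos by (simp add: B.fold_vec_def)
    \<comment> \<open>The locale speaks of sums only, so the difference is handled by adding the
      block of \<open>w\<close> back.\<close>
    moreover have "l j (\<lambda>s. u $ (r * a + s))
        = l j (\<lambda>s. u $ (r * a + s) - w $ (r * a + s)) + l j (\<lambda>s. w $ (r * a + s))"
      by (subst B.add[symmetric]) simp
    ultimately show ?thesis by simp
  qed
  hence "\<forall>s<a. u $ (r * a + s) - w $ (r * a + s) = 0" using sep[rule_format] by blast
  from this[rule_format, of "t mod a"] show "u $ t = w $ t"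
    using B.pos by (simp add: r_def)
qed (use u w in simp)

text \<open>Under every functional a run of the new code becomes a run of the old one, which
  decodes; hence the new output and the demanded message have the same images and are equal. Message
  and edge lengths grow by the same factor \<open>a\<close>, so the rate is kept.\<close>

lemma linearly_achievable_same_CHAR:
  assumes ch: "CHAR('f::{field,finite}) = CHAR('k::{field,finite})"
    and N: "is_network N" and ach: "linearly_achievable TYPE('f) N r"
  shows "linearly_achievable TYPE('k) N r"
proof -
  obtain C :: "'f code" where sol: "is_solution N C" and lin: "is_linear N C"
    and rate: "rate_vector N C = r" using ach by (auto simp: linearly_achievable_def)
  have code: "is_code N C" using sol by (simp add: is_solution_def)
  obtain M D
    where MD: "\<forall>e\<in>arcs (graph N).
      M e \<in> carrier_mat (edge_len C) (sum_list (input_lens N C (tail (graph N) e))) \<and>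
      (\<forall>vs\<in>input_space N C (tail (graph N) e). edge_fun C e vs = M e *\<^sub>v concat_vec vs)"
    "\<forall>v\<in>receivers N. \<forall>i\<in>demands N v.
      D v i \<in> carrier_mat (msg_len C i) (sum_list (input_lens N C v)) \<and>
      (\<forall>vs\<in>input_space N C v. dec_fun C v i vs = D v i *\<^sub>v concat_vec vs)"
    by (rule is_linearE[OF lin])
  have M: "M e \<in> carrier_mat (edge_len C) (sum_list (input_lens N C (tail (graph N) e)))"
    if "e \<in> arcs (graph N)" for e using MD(1) that by blast
  have Mf: "edge_fun C e vs = M e *\<^sub>v concat_vec vs"
    if "e \<in> arcs (graph N)" "vs \<in> input_space N C (tail (graph N) e)" for e vs
    using MD(1) that by blast
  have D: "D v i \<in> carrier_mat (msg_len C i) (sum_list (input_lens N C v))"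
    if "v \<in> receivers N" "i \<in> demands N v" for v i using MD(2) that by blast
  have Df: "dec_fun C v i vs = D v i *\<^sub>v concat_vec vs"
    if "v \<in> receivers N" "i \<in> demands N v" "vs \<in> input_space N C v" for v i vs
    using MD(2) that by blast
  obtain a and \<rho> :: "'f \<Rightarrow> nat \<Rightarrow> nat \<Rightarrow> 'k" and l :: "nat \<Rightarrow> (nat \<Rightarrow> 'k) \<Rightarrow> 'f"
    where L': "\<forall>j. block_functional a \<rho> (l j)"
      and sep: "\<forall>v. (\<forall>j. l j v = 0) \<longrightarrow> (\<forall>s<a. v s = 0)"
    by (rule block_functionals_exist[OF ch])
  have L: "block_functional a \<rho> (l j)" for j using L' by blast
  \<comment> \<open>Only \<open>fold_vec\<close> involves the functional: \<open>B.fold_vec\<close>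
    takes the index \<open>j\<close>, while \<open>B.blow_up\<close> is common to all of
    them.\<close>
  interpret B: block_functional a \<rho> "l j" for j by (rule L)
  define C' where "C' = matrix_code (\<lambda>i. msg_len C i * a) (edge_len C * a)
    (\<lambda>e. B.blow_up (M e)) (\<lambda>v i. B.blow_up (D v i))"
  have mult: "sum_list (map (\<lambda>m. m * a) xs) = sum_list xs * a" for xs
    by (induction xs) (simp_all add: distrib_right)
  have lens: "input_lens N C' v = map (\<lambda>m. m * a) (input_lens N C v)" for v
    by (auto simp: input_lens_def C'_def split: sum.split)
  have sum_lens: "sum_list (input_lens N C' v) = sum_list (input_lens N C v) * a" for v
    by (simp only: lens mult)
  have blow: "B.blow_up A \<in> carrier_mat (p * a) (q * a)" if "A \<in> carrier_mat p q" for A p q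
    using that by (auto simp: B.blow_up_def)
  have len: "edge_len C * a \<ge> 1" using code B.pos by (simp add: is_code_def)
  have code': "is_code N C'"
    unfolding C'_def
    by (rule matrix_code_linear[OF len]; unfold C'_def[symmetric] sum_lens; intro blow M D; assumption)
  have lin': "is_linear N C'"
    unfolding C'_def
    by (rule matrix_code_linear[OF len]; unfold C'_def[symmetric] sum_lens; intro blow M D; assumption)
  have "is_solution N C'" unfolding is_solution_def
  proof (intro conjI ballI allI impI)
    show "is_code N C'" by (rule code')
    fix x c v i
    assume x: "x \<in> message_values N C'" and c: "carried N C' x c"
      and v: "v \<in> receivers N" and i: "i \<in> demands N v"
    note car = carried_in_carrier[OF N code' x c]
    \<comment> \<open>\<open>X j\<close> and \<open>Y j\<close> are the images of the messages and
      of the carried vectors under the \<open>j\<close>-th functional.\<close>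
    define X where "X j k = B.fold_vec j (x k)" for j k
    define Y where "Y j e = B.fold_vec j (c e)" for j e
    have fold: "map (B.fold_vec j) (map (case_sum x c) (inputs N v))
        = map (case_sum (X j) (Y j)) (inputs N v)" for j v
      by (auto simp: X_def Y_def split: sum.split)
    have dims: "map dim_vec (map (case_sum x c) (inputs N v)) = map (\<lambda>m. m * a) (input_lens N C v)" for v
      using car(2)[of v] by (simp only: input_space_def mem_Collect_eq lens)
    have space: "map (case_sum (X j) (Y j)) (inputs N v) \<in> input_space N C v" for j v
    proof -
      have "map dim_vec (map (B.fold_vec j) (map (case_sum x c) (inputs N v)))
          = map (\<lambda>m. m div a) (map dim_vec (map (case_sum x c) (inputs N v)))"
        by (simp add: B.fold_vec_def)
      also have "\<dots> = input_lens N C v"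
        unfolding dims using B.pos by (simp add: comp_def)
      finally show ?thesis by (simp only: fold input_space_def mem_Collect_eq)
    qed
    \<comment> \<open>Stated for any matrix of fitting width, so that it serves edges and decoders
      alike.\<close>
    have dec: "B.fold_vec j (B.blow_up A *\<^sub>v concat_vec (map (case_sum x c) (inputs N v)))
        = A *\<^sub>v concat_vec (map (case_sum (X j) (Y j)) (inputs N v))"
      if A: "A \<in> carrier_mat p (sum_list (input_lens N C v))" for A p j v
    proof -
      have "a dvd dim_vec w" if "w \<in> set (map (case_sum x c) (inputs N v))" for w
      proof -
        have "dim_vec w \<in> set (map dim_vec (map (case_sum x c) (inputs N v)))"
          using that by (simp only: set_map imageI)
        thus ?thesis unfolding dims by auto
      qed
      hence "B.fold_vec j (concat_vec (map (case_sum x c) (inputs N v)))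
          = concat_vec (map (case_sum (X j) (Y j)) (inputs N v))"
        by (subst B.fold_vec_concat_vec) (simp_all only: fold)
      moreover have "dim_vec (concat_vec (map (case_sum x c) (inputs N v))) = dim_col A * a"
        unfolding dim_concat_vec dims using A
by (simp add: mult)
      ultimately show ?thesis by (simp add: B.fold_vec_blow_up)
    qed
    have "X j \<in> message_values N C" for j
      using x B.pos by (auto simp: message_values_def X_def C'_def B.fold_vec_def intro!: carrier_vecI)
    moreover have "carried N C (X j) (Y j)" for j
      unfolding carried_def
    proof
      fix e assume e: "e \<in> arcs (graph N)"
      have "Y j e = B.fold_vec j (B.blow_up (M e) *\<^sub>v
          concat_vec (map (case_sum x c) (inputs N (tail (graph N) e))))"
        using c e by (simp add: Y_def carried_def C'_def)
      also have "\<dots> = M e *\<^sub>v concat_vec (map (case_sum (X j) (Y j)) (inputs N (tail (graph N) e)))"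
        by (rule dec) (rule M[OF e])
      also have "\<dots> = edge_fun C e (map (case_sum (X j) (Y j)) (inputs N (tail (graph N) e)))"
        using Mf[OF e space] by simp
      finally show "Y j e = edge_fun C e (map (case_sum (X j) (Y j)) (inputs N (tail (graph N) e)))" .
    qed
    ultimately have "dec_fun C v i (map (case_sum (X j) (Y j)) (inputs N v)) = X j i" for j
      using sol v i by (auto simp: is_solution_def)
    \<comment> \<open>Folding commutes with decoding, so correctness of the old code is seen through
      every functional.\<close>
    hence eq: "B.fold_vec j (dec_fun C' v i (map (case_sum x c) (inputs N v))) = B.fold_vec j (x i)" for j
      using dec[OF D[OF v i]] Df[OF v i space] by (simp add: C'_def X_def)
    have "i < num_msgs N" using N v i by (auto simp: is_network_def)
    hence "x i \<in> carrier_vec (msg_len C i * a)" using x by (auto simp: message_values_def C'_def)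
    moreover have "dec_fun C' v i (map (case_sum x c) (inputs N v)) \<in> carrier_vec (msg_len C i * a)"
      using carrier_matD(1)[OF blow[OF D[OF v i]]] by (intro carrier_vecI) (simp add: C'_def)
    ultimately show "dec_fun C' v i (map (case_sum x c) (inputs N v)) = x i"
      using block_functional_separates[OF L sep _ _ eq] by blast
  qed
  moreover have "rate_vector N C' = r"
    using rate B.pos by (auto simp: rate_vector_def C'_def)
  ultimately show ?thesis using lin' by (auto simp: linearly_achievable_def)
qed

section \<open>The bottleneck obstruction\<close>

lemma finite_carrier_vec: "finite (carrier_vec n :: 'a::finite vec set)"
proof -
  have "carrier_vec n \<subseteq> vec_of_list ` {xs :: 'a list. set xs \<subseteq> UNIV \<and> length xs = n}"
  proof
    fix v :: "'a vec" assume "v \<in> carrier_vec n"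
    hence "v = vec_of_list (list_of_vec v)" "length (list_of_vec v) = n" by (simp_all add: vec_list)
    thus "v \<in> vec_of_list ` {xs. set xs \<subseteq> UNIV \<and> length xs = n}" by blast
  qed
  moreover have "finite {xs :: 'a list. set xs \<subseteq> UNIV \<and> length xs = n}"
    by (rule finite_lists_length_eq) simp
  ultimately show ?thesis by (meson finite_imageI finite_subset)
qed

lemma vec_add_eq_right_imp_zero:
  fixes u v :: "'a::ab_group_add vec"
  assumes u: "u \<in> carrier_vec n" and v: "v \<in> carrier_vec n" and eq: "u + v = v"
  shows "u = 0\<^sub>v n"
proof (rule eq_vecI)
  fix i assume "i < dim_vec (0\<^sub>v n :: 'a vec)"
  hence i: "i < n" by simp
  have "(u + v) $ i = v $ i" by (simp only: eq)
  thus "u $ i = 0\<^sub>v n $ i" using u v i by simp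
qed (use u in simp)

text \<open>A trivial kernel makes an additive map injective, and an injective self-map of a finite
  set is surjective. This takes the place of rank arguments.\<close>

lemma additive_endo_surj:
  fixes f :: "'a::{field,finite} vec \<Rightarrow> 'a vec"
  assumes carr: "\<And>u. u \<in> carrier_vec n \<Longrightarrow> f u \<in> carrier_vec n"
    and add: "\<And>u v. u \<in> carrier_vec n \<Longrightarrow> v \<in> carrier_vec n \<Longrightarrow> f (u + v) = f u + f v"
    and ker: "\<And>u. u \<in> carrier_vec n \<Longrightarrow> f u = 0\<^sub>v n \<Longrightarrow> u = 0\<^sub>v n"
    and w: "w \<in> carrier_vec n"
  obtains u where "u \<in> carrier_vec n" "f u = w"
proof -
  have "inj_on f (carrier_vec n)"
  proof (rule inj_onI)
    fix u v assume u: "u \<in> carrier_vec n" and v: "v \<in> carrier_vec n" and eq: "f u = f v"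
    have uv: "u = (u - v) + v" using u v by (intro eq_vecI) auto
    have d: "u - v \<in> carrier_vec n" using u v by simp
    have "f (u - v) + f v = f v" using add[OF d v] eq by (simp only: uv[symmetric])
    hence "f (u - v) = 0\<^sub>v n" by (rule vec_add_eq_right_imp_zero[OF carr[OF d] carr[OF v]])
    hence "u - v = 0\<^sub>v n" by (rule ker[OF d])
    thus "u = v" using uv v by (simp add: left_zero_vec)
  qed
  moreover have "f ` carrier_vec n \<subseteq> carrier_vec n" using carr by blast
  ultimately have "f ` carrier_vec n = carrier_vec n"
    by (simp add: endo_inj_surj finite_carrier_vec)
  with w obtain u where "u \<in> carrier_vec n" "f u = w" by (metis imageE)
  thus ?thesis by (rule that)
qed

text \<open>
  \<open>G i\<close> for \<open>i \<le> m\<close> is what the \<open>i\<close>-th bottleneck carries, \<open>G (Suc m)\<close> what the one that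
  sees all messages carries. Up to a change of coordinates they must be
  \<open>\<Sum>j\<noteq>i. x j\<close> and \<open>\<Sum>j. x j\<close>.
\<close>

lemma bottleneck_obstruction:
  fixes G :: "nat \<Rightarrow> (nat \<Rightarrow> 'f::{field,finite} vec) \<Rightarrow> 'f vec" and n m :: nat
  defines "X \<equiv> {x. \<forall>j. x j \<in> carrier_vec n}"
  assumes carr: "\<And>i x. i \<le> Suc m \<Longrightarrow> x \<in> X \<Longrightarrow> G i x \<in> carrier_vec n"
    and add: "\<And>i x y. i \<le> Suc m \<Longrightarrow> x \<in> X \<Longrightarrow> y \<in> X \<Longrightarrow> G i (\<lambda>j. x j + y j) = G i x + G i y"
    and dep: "\<And>i x y. i \<le> m \<Longrightarrow> x \<in> X \<Longrightarrow> y \<in> X \<Longrightarrow>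
      (\<And>j. j \<le> m \<Longrightarrow> j \<noteq> i \<Longrightarrow> x j = y j) \<Longrightarrow> G i x = G i y"
    and ker: "\<And>i x. i \<le> m \<Longrightarrow> x \<in> X \<Longrightarrow> G (Suc m) x = 0\<^sub>v n \<Longrightarrow> G i x = 0\<^sub>v n \<Longrightarrow> x i = 0\<^sub>v n"
    and ker0: "\<And>x. x \<in> X \<Longrightarrow> (\<And>i. i \<le> m \<Longrightarrow> G i x = 0\<^sub>v n) \<Longrightarrow> x 0 = 0\<^sub>v n"
    and m: "of_nat m = (0 :: 'f)" "m \<ge> 1"
  shows "n = 0"
proof (rule ccontr)
  assume n: "n \<noteq> 0"
  define single where "single i u = (\<lambda>j. if j = i then u else 0\<^sub>v n)" for i :: nat and u :: "'f vec"
  have singleX: "single i u \<in> X" if "u \<in> carrier_vec n" for i u using that by (simp add: single_def X_def)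
  have XD: "x j \<in> carrier_vec n" if "x \<in> X" for x j using that by (simp add: X_def)
  have addX: "(\<lambda>j. x j + y j) \<in> X" if "x \<in> X" "y \<in> X" for x y using that by (simp add: X_def)
  have single_add: "single i (u + v) = (\<lambda>j. single i u j + single i v j)"
    if "u \<in> carrier_vec n" "v \<in> carrier_vec n" for i u v
    using that by (auto simp: single_def)
  have zX: "(\<lambda>_. 0\<^sub>v n) \<in> X" by (simp add: X_def)
  have G0: "G i (\<lambda>_. 0\<^sub>v n) = 0\<^sub>v n" if "i \<le> Suc m" for i
    using vec_add_eq_right_imp_zero[OF carr[OF that zX] carr[OF that zX]] add[OF that zX zX]
    by simp
  have single0: "single i (0\<^sub>v n) = (\<lambda>_. 0\<^sub>v n)" for i by (auto simp: single_def)
  have neg0: "u = 0\<^sub>v n" if "u \<in> carrier_vec n" "- u = 0\<^sub>v n" for u :: "'f vec"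
    using arg_cong[OF that(2), of uminus] by simp
  \<comment> \<open>Bottleneck \<open>i\<close> does not see message \<open>i\<close>, so only the
    hub, bottleneck \<open>Suc m\<close>, can tell \<open>single i u\<close> from zero.\<close>
  have ker_single: "u = 0\<^sub>v n" if "i \<le> m" "u \<in> carrier_vec n" "G (Suc m) (single i u) = 0\<^sub>v n" for i u
  proof -
    have "G i (single i u) = G i (\<lambda>_. 0\<^sub>v n)"
      by (rule dep) (use that singleX zX in \<open>auto simp: single_def\<close>)
    hence "single i u i = 0\<^sub>v n" using that by (intro ker[OF that(1) singleX[OF that(2)]]) (simp_all only: G0)
    thus ?thesis by (simp add: single_def)
  qed
  \<comment> \<open>Injectivity on one message gives surjectivity: each message alone can produce
    any value at the hub.\<close>
  have hub: "\<exists>t\<in>carrier_vec n. G (Suc m) (single i t) = w" if iw: "i \<le> m" "w \<in> carrier_vec n" for i w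
  proof -
    obtain t where "t \<in> carrier_vec n" "G (Suc m) (single i t) = w"
    proof (rule additive_endo_surj[where f = "\<lambda>t. G (Suc m) (single i t)" and n = n and w = w])
      show "G (Suc m) (single i (u + v)) = G (Suc m) (single i u) + G (Suc m) (single i v)"
        if "u \<in> carrier_vec n" "v \<in> carrier_vec n" for u v
        unfolding single_add[OF that] by (rule add) (use that singleX in auto)
    qed (use iw carr singleX ker_single in auto)
    thus ?thesis by blast
  qed
  \<comment> \<open>Cancel the hub by changing message \<open>i\<close> only. Bottleneck
    \<open>i\<close> does not notice, so receiver \<open>i\<close> must read zero; the change was
    zero, and so was the hub.\<close>
  have hub0: "G (Suc m) x = 0\<^sub>v n" if i: "i \<le> m" and x: "x \<in> X" "x i = 0\<^sub>v n" "G i x = 0\<^sub>v n" for i x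
  proof -
    have c: "G (Suc m) x \<in> carrier_vec n" using x by (simp add: carr)
    then obtain t where t: "t \<in> carrier_vec n" "G (Suc m) (single i t) = - G (Suc m) x"
      using hub[OF i, of "- G (Suc m) x"] by auto
    let ?y = "\<lambda>j. x j + single i t j"
    have y: "?y \<in> X" by (rule addX[OF x(1) singleX[OF t(1)]])
    have "G (Suc m) ?y = 0\<^sub>v n"
      using c t by (subst add) (auto simp: x singleX uminus_r_inv_vec)
    moreover have "G i ?y = G i x"
      by (rule dep) (use i x y XD[OF x(1)] in \<open>auto simp: single_def\<close>)
    ultimately have "?y i = 0\<^sub>v n" using x(3) by (intro ker[OF i y]) simp_all
    hence "t = 0\<^sub>v n" using x t by (simp add: single_def)
    hence "- G (Suc m) x = 0\<^sub>v n" using t(2) by (simp add: single0 G0)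
    with c show ?thesis by (rule neg0)
  qed
  \<comment> \<open>Converse of \<open>hub0\<close>. Now another message \<open>j\<close> is changed
    so as to cancel bottleneck \<open>i\<close>; by \<open>hub0\<close> the hub vanishes too, which
    forces the change to be zero.\<close>
  have side0: "G i x = 0\<^sub>v n" if i: "i \<le> m" and x: "x \<in> X" "x i = 0\<^sub>v n" "G (Suc m) x = 0\<^sub>v n" for i x
  proof -
    \<comment> \<open>An index other than \<open>i\<close>; it stays within \<open>m\<close> because
      \<open>m \<ge> 1\<close>.\<close>
    define j where "j = (if i = 0 then 1 else 0 :: nat)"
    have j: "j \<le> m" "j \<noteq> i" using m(2) by (auto simp: j_def)
    have c: "G i x \<in> carrier_vec n" using i x by (simp add: carr)
    obtain u where u: "u \<in> carrier_vec n" "G i (single j u) = - G i x"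
    proof (rule additive_endo_surj[where f = "\<lambda>u. G i (single j u)" and n = n and w = "- G i x"])
      show "G i (single j (u + v)) = G i (single j u) + G i (single j v)"
        if "u \<in> carrier_vec n" "v \<in> carrier_vec n" for u v
        unfolding single_add[OF that] by (rule add) (use that singleX i in auto)
      show "u = 0\<^sub>v n" if u: "u \<in> carrier_vec n" and z: "G i (single j u) = 0\<^sub>v n" for u
        using j z by (intro ker_single[OF j(1) u]) (rule hub0[OF i singleX[OF u]], auto simp: single_def)
    qed (use i carr singleX c in auto)
    let ?y = "\<lambda>k. x k + single j u k"
    have y: "?y \<in> X" by (rule addX[OF x(1) singleX[OF u(1)]])
    have "G i ?y = 0\<^sub>v n"
      using c u i by (subst add) (auto simp: x singleX uminus_r_inv_vec)
    moreover have "?y i = 0\<^sub>v n" using j x by (simp add: single_def)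
    ultimately have "G (Suc m) ?y = 0\<^sub>v n" using hub0[OF i y] by blast
    moreover have "G (Suc m) ?y = G (Suc m) (single j u)"
      using x u carr[of "Suc m" "single j u"] by (subst add) (auto simp: singleX)
    ultimately have "u = 0\<^sub>v n" using ker_single[OF j(1) u(1)] by simp
    hence "- G i x = 0\<^sub>v n" using u(2) i by (simp add: single0 G0)
    with c show ?thesis by (rule neg0)
  qed
  define v :: "'f vec" where "v = unit_vec n 0"
  have v: "v \<in> carrier_vec n" "v \<noteq> 0\<^sub>v n"
    using n by (auto simp: v_def vec_eq_iff unit_vec_def intro!: exI[of _ 0])
  \<comment> \<open>The change of coordinates: each \<open>t j\<close> alone shows the same nonzero
    \<open>v\<close> at the hub, so the hub counts the messages switched on.\<close>
  have "\<forall>j\<in>{..m}. \<exists>t\<in>carrier_vec n. G (Suc m) (single j t) = v" using hub v(1) by auto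
  then obtain t where t: "\<And>j. j \<le> m \<Longrightarrow> t j \<in> carrier_vec n"
      "\<And>j. j \<le> m \<Longrightarrow> G (Suc m) (single j (t j)) = v"
    by (metis atMost_iff)
  define x where "x J = (\<lambda>j. if j \<in> J then t j else 0\<^sub>v n)" for J
  have xX: "x J \<in> X" if "J \<subseteq> {..m}" for J using that t by (auto simp: x_def X_def)
  have Gx: "G (Suc m) (x J) = of_nat (card J) \<cdot>\<^sub>v v" if "finite J" "J \<subseteq> {..m}" for J
    using that
  proof (induction J)
    case empty
    have "x {} = (\<lambda>_. 0\<^sub>v n)" by (simp add: x_def)
    thus ?case using v by (auto simp: G0)
  next
    case (insert j J)
    have "x (insert j J) = (\<lambda>k. x J k + single j (t j) k)"
      using insert t by (auto simp: x_def single_def fun_eq_iff)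
    hence "G (Suc m) (x (insert j J)) = G (Suc m) (x J) + G (Suc m) (single j (t j))"
      using insert t by (simp add: add xX singleX)
    also have "\<dots> = of_nat (card J) \<cdot>\<^sub>v v + v" using insert t by simp
    also have "\<dots> = of_nat (card (insert j J)) \<cdot>\<^sub>v v"
      using insert v by (intro eq_vecI) (auto simp: algebra_simps)
    finally show ?case .
  qed
  \<comment> \<open>With message \<open>i\<close> switched off the hub carries \<open>m\<close>
    times \<open>v\<close>, which is zero in this field; \<open>side0\<close> then gives zero on
    bottleneck \<open>i\<close>, and switching message \<open>i\<close> on again does not affect
    it.\<close>
  have "G i (x {..m}) = 0\<^sub>v n" if i: "i \<le> m" for i
  proof -
    have "G (Suc m) (x ({..m} - {i})) = of_nat m \<cdot>\<^sub>v v" using Gx[of "{..m} - {i}"] i by simp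
    hence "G (Suc m) (x ({..m} - {i})) = 0\<^sub>v n" using v m(1) by auto
    hence "G i (x ({..m} - {i})) = 0\<^sub>v n" using i by (intro side0[OF i xX]) (auto simp: x_def)
    moreover have "G i (x {..m}) = G i (x ({..m} - {i}))"
      by (rule dep[OF i xX xX]) (auto simp: x_def)
    ultimately show ?thesis by simp
  qed
  \<comment> \<open>All bottlenecks other than the hub vanish, which forces \<open>t 0\<close> to be
    zero, although it yields \<open>v\<close> at the hub.\<close>
  hence "x {..m} 0 = 0\<^sub>v n" by (intro ker0[OF xX]) auto
  hence "v = 0\<^sub>v n" using t(2)[of 0] by (simp add: x_def single0 G0)
  thus False using v by simp
qed

section \<open>Scalar codes and linearity of the carried vectors\<close>

definition coeff_row :: "('s \<Rightarrow> 'a) \<Rightarrow> 's list \<Rightarrow> 'a mat" where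
  "coeff_row f ss = mat 1 (length ss) (\<lambda>(_, t). f (ss ! t))"

lemma concat_vec_singletons:
  assumes "\<And>s. s \<in> set ss \<Longrightarrow> dim_vec (g s) = 1"
  shows "concat_vec (map g ss) = vec (length ss) (\<lambda>t. g (ss ! t) $ 0)"
  using assms
proof (induction ss)
  case Nil
  show ?case by (rule eq_vecI) (simp_all add: concat_vec_def)
next
  case (Cons s ss)
  have IH: "concat_vec (map g ss) = vec (length ss) (\<lambda>t. g (ss ! t) $ 0)"
    using Cons by simp
  have s: "dim_vec (g s) = 1" using Cons.prems by simp
  have "concat_vec (map g (s # ss)) = g s @\<^sub>v vec (length ss) (\<lambda>t. g (ss ! t) $ 0)"
    using IH by (simp add: concat_vec_def)
  also have "\<dots> = vec (length (s # ss)) (\<lambda>t. g ((s # ss) ! t) $ 0)"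
    by (rule eq_vecI) (auto simp: s nth_Cons split: nat.split)
  finally show ?case .
qed

text \<open>Distinctness turns the sum over list positions into a sum over the set of inputs, so the
  order of the inputs drops out.\<close>

lemma coeff_row_mult:
  fixes f :: "'s \<Rightarrow> 'a::comm_ring_1"
  assumes "\<And>s. s \<in> set ss \<Longrightarrow> dim_vec (g s) = 1" and "distinct ss"
  shows "coeff_row f ss *\<^sub>v concat_vec (map g ss) = vec 1 (\<lambda>_. \<Sum>s\<in>set ss. f s * g s $ 0)"
proof (rule eq_vecI)
  fix i assume "i < dim_vec (vec 1 (\<lambda>_. \<Sum>s\<in>set ss. f s * g s $ 0))"
  hence i: "i = 0" by simp
  have "(coeff_row f ss *\<^sub>v concat_vec (map g ss)) $ 0
      = (\<Sum>t<length ss. f (ss ! t) * g (ss ! t) $ 0)"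
    by (simp add: coeff_row_def concat_vec_singletons assms(1) scalar_prod_def atLeast0LessThan)
  also have "\<dots> = (\<Sum>s\<in>set ss. f s * g s $ 0)"
    using sum.reindex_bij_betw[OF bij_betw_nth[OF assms(2) refl refl], of "\<lambda>s. f s * g s $ 0"] .
  finally show "(coeff_row f ss *\<^sub>v concat_vec (map g ss)) $ i
      = vec 1 (\<lambda>_. \<Sum>s\<in>set ss. f s * g s $ 0) $ i"
    by (simp add: i)
qed (simp add: coeff_row_def)

lemma distinct_inputs: "distinct (inputs N v)"
  by (auto simp: inputs_def distinct_map)

text \<open>With block length 1 a code is a family of coefficients on inputs, and checking a
  solution becomes arithmetic in the field.\<close>

lemma scalar_linearly_achievable:
  fixes \<alpha> :: "nat \<Rightarrow> nat + nat \<Rightarrow> 'a::{field,finite}"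
    and \<beta> :: "nat \<Rightarrow> nat \<Rightarrow> nat + nat \<Rightarrow> 'a"
  assumes N: "is_network N"
    and decodes: "\<And>x c v i.
      \<forall>e\<in>arcs (graph N). c e = (\<Sum>s\<in>set (inputs N (tail (graph N) e)). \<alpha> e s * case_sum x c s) \<Longrightarrow>
      v \<in> receivers N \<Longrightarrow> i \<in> demands N v \<Longrightarrow>
      (\<Sum>s\<in>set (inputs N v). \<beta> v i s * case_sum x c s) = x i"
  shows "linearly_achievable TYPE('a) N (vec (num_msgs N) (\<lambda>_. 1))"
proof -
  define C where "C = matrix_code (\<lambda>_. 1) 1
    (\<lambda>e. coeff_row (\<alpha> e) (inputs N (tail (graph N) e))) (\<lambda>v i. coeff_row (\<beta> v i) (inputs N v))"
  have "sum_list (map (case_sum (\<lambda>_. 1) (\<lambda>_. 1)) xs) = length xs" for xs :: "(nat + nat) list"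
    by (induction xs) (auto split: sum.split)
  hence lens: "sum_list (input_lens N C v) = length (inputs N v)" for v
    by (simp add: input_lens_def C_def)
  have row: "coeff_row f ss \<in> carrier_mat 1 (length ss)" for f :: "nat + nat \<Rightarrow> 'a" and ss
    by (simp add: coeff_row_def)
  have code: "is_code N C"
    unfolding C_def by (rule matrix_code_linear[OF order_refl]; unfold C_def[symmetric] lens; rule row)
  have lin: "is_linear N C"
    unfolding C_def by (rule matrix_code_linear[OF order_refl]; unfold C_def[symmetric] lens; rule row)
  have "is_solution N C" unfolding is_solution_def
  proof (intro conjI ballI allI impI)
    show "is_code N C" by (rule code)
    fix x c v i
    assume x: "x \<in> message_values N C" and c: "carried N C x c"
      and v: "v \<in> receivers N" and i: "i \<in> demands N v"
    define X where "X k = x k $ 0" for k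
    define Y where "Y e = c e $ 0" for e
    have XY: "case_sum x c s $ 0 = case_sum X Y s" for s by (simp add: X_def Y_def split: sum.split)
    have dims: "dim_vec (case_sum x c s) = 1" if "s \<in> set (inputs N v)" for s v
    proof -
      have "map dim_vec (map (case_sum x c) (inputs N v)) = input_lens N C v"
        using carried_in_carrier(2)[OF N code x c] by (simp only: input_space_def mem_Collect_eq)
      hence "\<forall>s\<in>set (inputs N v). dim_vec (case_sum x c s) = case_sum (msg_len C) (\<lambda>e. edge_len C) s"
        by (simp add: input_lens_def)
      thus ?thesis using that by (auto simp: C_def split: sum.splits)
    qed
    have row_eq: "coeff_row f (inputs N v) *\<^sub>v concat_vec (map (case_sum x c) (inputs N v))
        = vec 1 (\<lambda>_. \<Sum>s\<in>set (inputs N v). f s * case_sum X Y s)" for f v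
      using coeff_row_mult[of "inputs N v" "case_sum x c" f, OF dims distinct_inputs] by (simp only: XY)
    have "Y e = (\<Sum>s\<in>set (inputs N (tail (graph N) e)). \<alpha> e s * case_sum X Y s)"
      if e: "e \<in> arcs (graph N)" for e
    proof -
      have "c e = coeff_row (\<alpha> e) (inputs N (tail (graph N) e)) *\<^sub>v
          concat_vec (map (case_sum x c) (inputs N (tail (graph N) e)))"
        using c e by (simp add: carried_def C_def)
      thus ?thesis by (simp add: Y_def row_eq)
    qed
    hence "(\<Sum>s\<in>set (inputs N v). \<beta> v i s * case_sum X Y s) = X i"
      using v i by (intro decodes) auto
    hence "dec_fun C v i (map (case_sum x c) (inputs N v)) = vec 1 (\<lambda>_. X i)"
      by (simp add: C_def row_eq)
    also have "\<dots> = x i"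
    proof -
      have "i < num_msgs N" using N v i by (auto simp: is_network_def)
      hence "x i \<in> carrier_vec 1" using x by (auto simp: message_values_def C_def)
      thus ?thesis by (intro eq_vecI) (auto simp: X_def)
    qed
    finally show "dec_fun C v i (map (case_sum x c) (inputs N v)) = x i" .
  qed
  moreover have "rate_vector N C = vec (num_msgs N) (\<lambda>_. 1)"
    by (auto simp: rate_vector_def C_def)
  ultimately show ?thesis using lin by (auto simp: linearly_achievable_def)
qed

section \<open>Vanishing and superposition of carried vectors\<close>

lemma concat_vec_zero:
  assumes "\<And>w. w \<in> set vs \<Longrightarrow> w = 0\<^sub>v (dim_vec w)"
  shows "concat_vec vs = 0\<^sub>v (sum_list (map dim_vec vs))"
  using assms
proof (induction vs)
  case Nil
  show ?case by (rule eq_vecI) (simp_all add: concat_vec_def)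
next
  case (Cons w vs)
  have w: "w = 0\<^sub>v (dim_vec w)" using Cons.prems by simp
  have "concat_vec (w # vs) = 0\<^sub>v (dim_vec w) @\<^sub>v 0\<^sub>v (sum_list (map dim_vec vs))"
    using Cons w by (simp add: concat_vec_def)
  also have "\<dots> = 0\<^sub>v (dim_vec w + sum_list (map dim_vec vs))" by (rule eq_vecI) auto
  finally show ?case by simp
qed

lemma linear_map_on_zero:
  assumes f: "linear_map_on N C v d f" and vs: "vs \<in> input_space N C v"
    and z: "\<And>w. w \<in> set vs \<Longrightarrow> w = 0\<^sub>v (dim_vec w)"
  shows "f vs = 0\<^sub>v d"
proof -
  obtain A where A: "A \<in> carrier_mat d (sum_list (input_lens N C v))" "f vs = A *\<^sub>v concat_vec vs"
    using f vs by (auto simp: linear_map_on_def)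
  have "concat_vec vs = 0\<^sub>v (sum_list (input_lens N C v))"
    using concat_vec_zero[OF z] vs by (simp add: input_space_def)
  thus ?thesis using A by (intro eq_vecI) auto
qed

text \<open>Superposition: every edge applies one matrix to its concatenated inputs, and
  concatenation commutes with addition. Together with \<open>carried_unique\<close> this makes each
  carried vector an additive function of the messages.\<close>

lemma carried_add:
  assumes N: "is_network N" and C: "is_code N C" and lin: "is_linear N C"
    and x: "x \<in> message_values N C" "carried N C x c"
    and y: "y \<in> message_values N C" "carried N C y d"
  shows "carried N C (\<lambda>i. x i + y i) (\<lambda>e. c e + d e)"
  unfolding carried_def
proof
  fix e assume e: "e \<in> arcs (graph N)"
  let ?v = "tail (graph N) e"
  let ?x = "map (case_sum x c) (inputs N ?v)" and ?y = "map (case_sum y d) (inputs N ?v)"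
  let ?z = "map (\<lambda>s. case_sum x c s + case_sum y d s) (inputs N ?v)"
  have xs: "?x \<in> input_space N C ?v" by (rule carried_in_carrier(2)[OF N C x])
  have ys: "?y \<in> input_space N C ?v" by (rule carried_in_carrier(2)[OF N C y])
  have eq: "case_sum (\<lambda>i. x i + y i) (\<lambda>e. c e + d e) = (\<lambda>s. case_sum x c s + case_sum y d s)"
    by (auto split: sum.split)
  have "map dim_vec ?z = map dim_vec ?y" by simp
  hence zs: "?z \<in> input_space N C ?v"
    using ys by (simp only: input_space_def mem_Collect_eq)
  have dims: "dim_vec (case_sum x c s) = dim_vec (case_sum y d s)" if "s \<in> set (inputs N ?v)" for s
  proof -
    have "map dim_vec ?x = map dim_vec ?y"
      using xs ys by (simp only: input_space_def mem_Collect_eq)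
    thus ?thesis using that by simp
  qed
  have len: "concat_vec vs \<in> carrier_vec (sum_list (input_lens N C ?v))"
    if "vs \<in> input_space N C ?v" for vs
    using that by (intro carrier_vecI) (simp add: dim_concat_vec input_space_def)
  obtain A where A: "A \<in> carrier_mat (edge_len C) (sum_list (input_lens N C ?v))"
      "\<forall>vs\<in>input_space N C ?v. edge_fun C e vs = A *\<^sub>v concat_vec vs"
    using lin e unfolding is_linear_def linear_map_on_def by blast
  have "edge_fun C e ?z = A *\<^sub>v concat_vec ?z" by (rule A(2)[rule_format, OF zs])
  also have "\<dots> = A *\<^sub>v (concat_vec ?x + concat_vec ?y)"
    by (subst concat_vec_map_add) (simp_all add: dims)
  also have "\<dots> = A *\<^sub>v concat_vec ?x + A *\<^sub>v concat_vec ?y"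
    by (rule mult_add_distrib_mat_vec[OF A(1) len[OF xs] len[OF ys]])
  also have "\<dots> = edge_fun C e ?x + edge_fun C e ?y" using A(2) xs ys by simp
  also have "\<dots> = c e + d e" using x(2) y(2) e by (simp add: carried_def)
  finally show "c e + d e = edge_fun C e
      (map (case_sum (\<lambda>i. x i + y i) (\<lambda>e. c e + d e)) (inputs N ?v))"
    by (simp only: eq)
qed

section \<open>A network that tests the characteristic\<close>

text \<open>Node \<open>i\<close> of layer \<open>k\<close>; the pairing function keeps different
  nodes different.\<close>

definition node :: "nat \<Rightarrow> nat \<Rightarrow> nat" where
  "node k i = prod_encode (k, i)"

lemma node_eq_iff [simp]: "node k i = node k' i' \<longleftrightarrow> k = k' \<and> i = i'"
  by (simp add: node_def)

text \<open>
  Message \<open>j\<close> originates at \<open>node 0 j\<close>; the edge from \<open>node 1 i\<close> to \<open>node 2 i\<close> is a bottleneck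
  seeing all messages but the \<open>i\<close>-th (all of them if \<open>i = Suc m\<close>). Receiver \<open>node 3 i\<close> gets
  bottlenecks \<open>i\<close> and \<open>Suc m\<close>, and \<open>node 3 (Suc m)\<close> gets bottlenecks \<open>0, ..., m\<close>.
  An edge is named by the code of its pair of ends.
\<close>

definition char_edges :: "nat \<Rightarrow> (nat \<times> nat) set" where
  "char_edges m =
     {(node 0 j, node 1 i) | i j. i \<le> Suc m \<and> j \<le> m \<and> i \<noteq> j} \<union>
     {(node 1 i, node 2 i) | i. i \<le> Suc m} \<union>
     {(node 2 i, node 3 i) | i. i \<le> m} \<union>
     {(node 2 (Suc m), node 3 i) | i. i \<le> m} \<union>
     {(node 2 i, node 3 (Suc m)) | i. i \<le> m}"

text \<open>Reduction modulo \<open>Suc m\<close> makes \<open>node 3 i\<close> demand message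
  \<open>i\<close> for \<open>i \<le> m\<close>, and the last receiver \<open>node 3 (Suc m)\<close>
  demand message 0.\<close>

definition char_network :: "nat \<Rightarrow> network" where
  "char_network m =
     \<lparr>graph = \<lparr>verts = case_prod node ` ({..3} \<times> {..Suc m}), arcs = prod_encode ` char_edges m,
        tail = fst \<circ> prod_decode, head = snd \<circ> prod_decode\<rparr>,
      sources = node 0 ` {..m}, receivers = node 3 ` {..Suc m}, num_msgs = Suc m,
      origin = node 0, demands = \<lambda>v. {snd (prod_decode v) mod Suc m}\<rparr>"

lemma char_edges_subset:
  "char_edges m \<subseteq> (case_prod node ` ({..3} \<times> {..Suc m})) \<times> (case_prod node ` ({..3} \<times> {..Suc m}))"
  by (force simp: char_edges_def)

text \<open>Every edge leads to the next layer, so the layer number is a measure that excludes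
  cycles.\<close>

lemma is_network_char_network: "is_network (char_network m)"
proof -
  let ?G = "graph (char_network m)"
  have fin: "finite (char_edges m)"
    by (rule finite_subset[OF char_edges_subset]) simp
  have "fin_digraph ?G"
    using char_edges_subset[of m] fin
    by unfold_locales (auto simp: char_network_def)
  moreover have "arcs_ends ?G \<subseteq> measure (\<lambda>v. fst (prod_decode v))"
    by (auto simp: arcs_ends_def arc_to_ends_def char_network_def char_edges_def node_def)
  hence "acyclic (arcs_ends ?G)"
    using wf_acyclic[OF wf_measure] acyclic_subset by blast
  ultimately show ?thesis
    by (auto simp: is_network_def char_network_def)
qed

lemma set_inputs_char_network:
  "set (inputs (char_network m) v) =
     Inl ` {i. i \<le> m \<and> node 0 i = v} \<union> (\<lambda>u. Inr (prod_encode (u, v))) ` {u. (u, v) \<in> char_edges m}"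
  unfolding set_inputs[OF is_network_char_network]
  by (force simp: char_network_def in_arcs_def less_Suc_eq_le)

lemma inputs_char_network:
  "j \<le> m \<Longrightarrow> set (inputs (char_network m) (node 0 j)) = {Inl j}"
  "i \<le> Suc m \<Longrightarrow> set (inputs (char_network m) (node 1 i)) =
     (\<lambda>j. Inr (prod_encode (node 0 j, node 1 i))) ` ({..m} - {i})"
  "i \<le> Suc m \<Longrightarrow> set (inputs (char_network m) (node 2 i)) = {Inr (prod_encode (node 1 i, node 2 i))}"
  "i \<le> m \<Longrightarrow> set (inputs (char_network m) (node 3 i)) =
     {Inr (prod_encode (node 2 i, node 3 i)), Inr (prod_encode (node 2 (Suc m), node 3 i))}"
  "set (inputs (char_network m) (node 3 (Suc m))) =
     (\<lambda>i. Inr (prod_encode (node 2 i, node 3 (Suc m)))) ` {..m}"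
  by (auto simp: set_inputs_char_network char_edges_def)

lemma char_network_sel [simp]:
  "tail (graph (char_network m)) (prod_encode (u, v)) = u"
  "prod_encode (u, v) \<in> arcs (graph (char_network m)) \<longleftrightarrow> (u, v) \<in> char_edges m"
  "num_msgs (char_network m) = Suc m"
  "receivers (char_network m) = node 3 ` {..Suc m}"
  "demands (char_network m) (node k i) = {i mod Suc m}"
  by (auto simp: char_network_def node_def)

lemma char_edgesI:
  "i \<le> Suc m \<Longrightarrow> j \<le> m \<Longrightarrow> i \<noteq> j \<Longrightarrow> (node 0 j, node 1 i) \<in> char_edges m"
  "i \<le> Suc m \<Longrightarrow> (node 1 i, node 2 i) \<in> char_edges m"
  "i \<le> m \<Longrightarrow> (node 2 i, node 3 i) \<in> char_edges m"
  "i \<le> m \<Longrightarrow> (node 2 (Suc m), node 3 i) \<in> char_edges m"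
  "i \<le> m \<Longrightarrow> (node 2 i, node 3 (Suc m)) \<in> char_edges m"
  by (auto simp: char_edges_def)

section \<open>Solvability when m is nonzero in the field\<close>

text \<open>Every edge carries the sum of the inputs of its tail. With \<open>S\<close> the sum of
  all messages, receiver \<open>i \<le> m\<close> subtracts \<open>S - x i\<close> from
  \<open>S\<close>. The last receiver adds up all \<open>S - x j\<close>, which gives
  \<open>m\<close> times \<open>S\<close>, divides by \<open>m\<close> and subtracts
  \<open>S - x 0\<close>.\<close>

lemma char_network_achievable:
  assumes m: "of_nat m \<noteq> (0 :: 'a::{field,finite})"
  shows "linearly_achievable TYPE('a) (char_network m) (vec (Suc m) (\<lambda>_. 1))"
proof -
  \<comment> \<open>Here \<open>a\<close> is the index of the bottleneck from which the incoming
    edge comes, read off the code of the edge.\<close>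
  define \<beta> :: "nat \<Rightarrow> nat \<Rightarrow> nat + nat \<Rightarrow> 'a" where
    "\<beta> v i s = (let a = snd (prod_decode (fst (prod_decode (projr s)))) in
       if v = node 3 (Suc m) then 1 / of_nat m - (if a = 0 then 1 else 0)
       else if a = Suc m then 1 else - 1)" for v i s
  have "linearly_achievable TYPE('a) (char_network m) (vec (num_msgs (char_network m)) (\<lambda>_. 1))"
  proof (rule scalar_linearly_achievable[where \<alpha> = "\<lambda>_ _. 1" and \<beta> = \<beta>])
    show "is_network (char_network m)" by (rule is_network_char_network)
    fix x c :: "nat \<Rightarrow> 'a" and v i
    assume c: "\<forall>e\<in>arcs (graph (char_network m)).
        c e = (\<Sum>s\<in>set (inputs (char_network m) (tail (graph (char_network m)) e)). 1 * case_sum x c s)"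
      and v: "v \<in> receivers (char_network m)" and i: "i \<in> demands (char_network m) v"
    have edge: "c (prod_encode (u, w)) = (\<Sum>s\<in>set (inputs (char_network m) u). case_sum x c s)"
      if "(u, w) \<in> char_edges m" for u w
      using c that by auto
    have c01: "c (prod_encode (node 0 j, node 1 i)) = x j" if "i \<le> Suc m" "j \<le> m" "i \<noteq> j" for i j
      using edge[OF char_edgesI(1)[OF that]] inputs_char_network(1)[OF that(2)] by simp
    \<comment> \<open>For \<open>i = Suc m\<close> nothing is removed and the sum runs over all
      messages.\<close>
    have c12: "c (prod_encode (node 1 i, node 2 i)) = (\<Sum>j\<in>{..m} - {i}. x j)" if "i \<le> Suc m" for i
    proof -
      have "c (prod_encode (node 1 i, node 2 i))
          = (\<Sum>j\<in>{..m} - {i}. c (prod_encode (node 0 j, node 1 i)))"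
        using edge[OF char_edgesI(2)[OF that]] inputs_char_network(2)[OF that]
        by (simp add: sum.reindex inj_on_def)
      also have "\<dots> = (\<Sum>j\<in>{..m} - {i}. x j)" by (rule sum.cong) (use that c01 in auto)
      finally show ?thesis .
    qed
    have c23: "c (prod_encode (node 2 i, w)) = (\<Sum>j\<in>{..m} - {i}. x j)"
      if "i \<le> Suc m" "(node 2 i, w) \<in> char_edges m" for i w
      using edge[OF that(2)] inputs_char_network(3)[OF that(1)] c12[OF that(1)] by simp
    define S where "S = (\<Sum>j\<le>m. x j)"
    have S: "(\<Sum>j\<in>{..m} - {i}. x j) = S - x i" if "i \<le> m" for i
      using that by (simp add: S_def sum_diff1)
    obtain l where l: "v = node 3 l" "l \<le> Suc m" using v by auto
    show "(\<Sum>s\<in>set (inputs (char_network m) v). \<beta> v i s * case_sum x c s) = x i"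
    proof (cases "l = Suc m")
      case True
      have "(\<Sum>s\<in>set (inputs (char_network m) v). \<beta> v i s * case_sum x c s)
          = (\<Sum>j\<le>m. (1 / of_nat m - (if j = 0 then 1 else 0)) * c (prod_encode (node 2 j, node 3 (Suc m))))"
        using inputs_char_network(5)[of m] True l
        by (simp add: sum.reindex inj_on_def \<beta>_def node_def)
      also have "\<dots> = (\<Sum>j\<le>m. (1 / of_nat m - (if j = 0 then 1 else 0)) * (S - x j))"
        by (rule sum.cong) (simp_all add: c23 char_edgesI S)
      also have "\<dots> = (\<Sum>j\<le>m. (S - x j) / of_nat m) - (\<Sum>j\<le>m. if j = 0 then S - x 0 else 0)"
        unfolding sum_subtractf[symmetric] by (rule sum.cong) (auto simp: algebra_simps)
      \<comment> \<open>There are \<open>Suc m\<close> copies of \<open>S\<close>, and the messages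
        subtracted from them add up to one \<open>S\<close>, which leaves \<open>m\<close>
        copies.\<close>
      also have "\<dots> = (of_nat (Suc m) * S - S) / of_nat m - (S - x 0)"
        by (simp add: sum_divide_distrib[symmetric] sum_subtractf S_def)
      also have "\<dots> = x 0" using m by (simp add: field_simps)
      finally show ?thesis using i True l by simp
    next
      case False
      with l have lm: "l \<le> m" by simp
      have "(\<Sum>s\<in>set (inputs (char_network m) v). \<beta> v i s * case_sum x c s)
          = c (prod_encode (node 2 (Suc m), node 3 l)) - c (prod_encode (node 2 l, node 3 l))"
        using inputs_char_network(4)[OF lm] False l
        by (simp add: \<beta>_def node_def)
      also have "\<dots> = S - (S - x l)"
        using lm S[OF lm] by (simp add: c23 char_edgesI S_def)
      finally show ?thesis using i lm l by simp
    qed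
  qed
  thus ?thesis by simp
qed

section \<open>Failure when m is zero in the field\<close>

text \<open>Linear functions send zero inputs to zero. The length is left existential so that
  messages and edge vectors are treated alike.\<close>

lemma carried_zero:
  assumes N: "is_network N" and C: "is_code N C" and lin: "is_linear N C"
    and x: "x \<in> message_values N C" "carried N C x c"
  shows "e \<in> arcs (graph N) \<Longrightarrow>
      (\<And>s. s \<in> set (inputs N (tail (graph N) e)) \<Longrightarrow> \<exists>n. case_sum x c s = 0\<^sub>v n) \<Longrightarrow>
      c e = 0\<^sub>v (edge_len C)"
    and "v \<in> receivers N \<Longrightarrow> i \<in> demands N v \<Longrightarrow>
      (\<And>s. s \<in> set (inputs N v) \<Longrightarrow> \<exists>n. case_sum x c s = 0\<^sub>v n) \<Longrightarrow>
      dec_fun C v i (map (case_sum x c) (inputs N v)) = 0\<^sub>v (msg_len C i)"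
proof -
  have z: "f (map (case_sum x c) (inputs N v)) = 0\<^sub>v d"
    if f: "linear_map_on N C v d f"
      and ins: "\<And>s. s \<in> set (inputs N v) \<Longrightarrow> \<exists>n. case_sum x c s = 0\<^sub>v n" for v d f
  proof (rule linear_map_on_zero[OF f carried_in_carrier(2)[OF N C x]])
    fix w assume "w \<in> set (map (case_sum x c) (inputs N v))"
    then obtain s where s: "s \<in> set (inputs N v)" "w = case_sum x c s" by auto
    obtain n where "case_sum x c s = 0\<^sub>v n" using ins[OF s(1)] by blast
    with s show "w = 0\<^sub>v (dim_vec w)" by simp
  qed
  show "c e = 0\<^sub>v (edge_len C)" if "e \<in> arcs (graph N)"
    "\<And>s. s \<in> set (inputs N (tail (graph N) e)) \<Longrightarrow> \<exists>n. case_sum x c s = 0\<^sub>v n"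
  proof -
    have "linear_map_on N C (tail (graph N) e) (edge_len C) (edge_fun C e)"
      using lin that(1) by (simp add: is_linear_def)
    from z[OF this that(2)] show ?thesis using x(2) that(1) by (simp add: carried_def)
  qed
  show "dec_fun C v i (map (case_sum x c) (inputs N v)) = 0\<^sub>v (msg_len C i)"
    if "v \<in> receivers N" "i \<in> demands N v"
      "\<And>s. s \<in> set (inputs N v) \<Longrightarrow> \<exists>n. case_sum x c s = 0\<^sub>v n"
    using lin that by (intro z) (auto simp: is_linear_def)
qed

text \<open>Rate 1 forces every message to have the edge length \<open>n\<close>, so messages and
  bottleneck vectors live in the same space. The contents of the bottlenecks then satisfy the
  conditions of \<open>bottleneck_obstruction\<close>, whose conclusion \<open>n = 0\<close>
  contradicts \<open>n \<ge> 1\<close>.\<close>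

lemma char_network_not_achievable:
  assumes m: "of_nat m = (0 :: 'a::{field,finite})" "m \<ge> 1"
  shows "\<not> linearly_achievable TYPE('a) (char_network m) (vec (Suc m) (\<lambda>_. 1))"
proof
  let ?N = "char_network m"
  note N = is_network_char_network[of m]
  assume "linearly_achievable TYPE('a) ?N (vec (Suc m) (\<lambda>_. 1))"
  then obtain C :: "'a code" where sol: "is_solution ?N C" and lin: "is_linear ?N C"
    and rate: "rate_vector ?N C = vec (Suc m) (\<lambda>_. 1)" by (auto simp: linearly_achievable_def)
  have code: "is_code ?N C" using sol by (simp add: is_solution_def)
  define n where "n = edge_len C"
  have n: "n \<ge> 1" using code by (simp add: is_code_def n_def)
  have len: "msg_len C j = n" if "j \<le> m" for j
  proof -
    have "vec_index (rate_vector ?N C) j = vec_index (vec (Suc m) (\<lambda>_. 1)) j" by (simp only: rate)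
    hence "(of_nat (msg_len C j) :: rat) = of_nat n"
      using that n by (simp add: rate_vector_def n_def)
    thus ?thesis by simp
  qed
  define X :: "(nat \<Rightarrow> 'a vec) set" where "X = {x. \<forall>j. x j \<in> carrier_vec n}"
  have msg: "x \<in> message_values ?N C" if "x \<in> X" for x
    using that len by (auto simp: X_def message_values_def)
  \<comment> \<open>Fixing one run for each choice of messages makes the bottleneck contents
    functions of the messages.\<close>
  define cv where "cv x = (SOME c. carried ?N C x c)" for x
  have cv: "carried ?N C x (cv x)" for x
    unfolding cv_def by (rule someI_ex[OF carried_exists[OF N]])
  define G where "G i x = cv x (prod_encode (node 1 i, node 2 i))" for i x
  have edge_cong: "cv x (prod_encode (u, w)) = cv y (prod_encode (u, w))"
    if "(u, w) \<in> char_edges m"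
      "\<And>s. s \<in> set (inputs ?N u) \<Longrightarrow> case_sum x (cv x) s = case_sum y (cv y) s" for x y u w
  proof -
    have "map (case_sum x (cv x)) (inputs ?N u) = map (case_sum y (cv y)) (inputs ?N u)"
      using that(2) by simp
    thus ?thesis using cv[of x] cv[of y] that(1) unfolding carried_def
      by (metis char_network_sel(1,2))
  qed
  \<comment> \<open>The bottleneck edge is the only input of \<open>node 2 i\<close>, so the edges
    leaving that node vanish with it.\<close>
  have relay: "cv x (prod_encode (node 2 i, w)) = 0\<^sub>v n"
    if "x \<in> X" "i \<le> Suc m" "(node 2 i, w) \<in> char_edges m" "G i x = 0\<^sub>v n" for x i w
    unfolding n_def
    by (rule carried_zero(1)[OF N code lin msg[OF that(1)] cv])
      (use that inputs_char_network(3)[OF that(2)] in \<open>auto simp: G_def\<close>)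
  \<comment> \<open>A receiver whose inputs all vanish outputs zero, and its output is the demanded
    message.\<close>
  have decode: "x (l mod Suc m) = 0\<^sub>v n"
    if x: "x \<in> X" and l: "l \<le> Suc m"
      and z: "\<And>s. s \<in> set (inputs ?N (node 3 l)) \<Longrightarrow> \<exists>n. case_sum x (cv x) s = 0\<^sub>v n" for x l
  proof -
    have r: "node 3 l \<in> receivers ?N" "l mod Suc m \<in> demands ?N (node 3 l)" using l by auto
    have "dec_fun C (node 3 l) (l mod Suc m) (map (case_sum x (cv x)) (inputs ?N (node 3 l)))
        = x (l mod Suc m)"
      using sol msg[OF x] cv[of x] r unfolding is_solution_def by blast
    hence "x (l mod Suc m)
        = dec_fun C (node 3 l) (l mod Suc m) (map (case_sum x (cv x)) (inputs ?N (node 3 l)))"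
      by (rule sym)
    also have "\<dots> = 0\<^sub>v (msg_len C (l mod Suc m))"
      by (rule carried_zero(2)[OF N code lin msg[OF x] cv r z])
    also have "\<dots> = 0\<^sub>v n" by (simp add: len less_Suc_eq_le[symmetric])
    finally show ?thesis .
  qed
  have "n = 0"
  proof (rule bottleneck_obstruction[where G = G and m = m and n = n, folded X_def])
    show "of_nat m = (0 :: 'a)" "m \<ge> 1" by (fact m)+
    show "G i x \<in> carrier_vec n" if "i \<le> Suc m" "x \<in> X" for i x
      using carried_in_carrier(1)[OF N code msg[OF that(2)] cv] char_edgesI(2)[OF that(1)]
      by (simp add: G_def n_def)
    \<comment> \<open>The sum of two runs is a run on the sum of the messages, and by uniqueness it
      agrees with the chosen one on the edges.\<close>
    show "G i (\<lambda>j. x j + y j) = G i x + G i y" if "i \<le> Suc m" "x \<in> X" "y \<in> X" for i x y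
      unfolding G_def
      using carried_unique[OF N cv carried_add[OF N code lin msg[OF that(2)] cv msg[OF that(3)] cv]]
        char_edgesI(2)[OF that(1)] by simp
    \<comment> \<open>Two steps back from bottleneck \<open>i\<close> only the messages other than
      \<open>i\<close> are reached.\<close>
    show "G i x = G i y"
      if i: "i \<le> m" and agree: "\<And>j. j \<le> m \<Longrightarrow> j \<noteq> i \<Longrightarrow> x j = y j" for i x y
      unfolding G_def
    proof (rule edge_cong)
      have i': "i \<le> Suc m" using i by simp
      show "(node 1 i, node 2 i) \<in> char_edges m" by (rule char_edgesI(2)[OF i'])
      fix s assume "s \<in> set (inputs ?N (node 1 i))"
      then obtain j where j: "j \<le> m" "j \<noteq> i" "s = Inr (prod_encode (node 0 j, node 1 i))"
        unfolding inputs_char_network(2)[OF i'] by auto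
      have "cv x (prod_encode (node 0 j, node 1 i)) = cv y (prod_encode (node 0 j, node 1 i))"
        by (rule edge_cong[OF char_edgesI(1)[OF i' j(1)]])
          (use agree j in \<open>auto simp: inputs_char_network(1)\<close>)
      thus "case_sum x (cv x) s = case_sum y (cv y) s" using j by simp
    qed
    show "x i = 0\<^sub>v n" if "i \<le> m" "x \<in> X" "G (Suc m) x = 0\<^sub>v n" "G i x = 0\<^sub>v n" for i x
    proof -
      have i: "i \<le> Suc m" using that(1) by simp
      have "x (i mod Suc m) = 0\<^sub>v n"
      proof (rule decode[OF that(2) i])
        fix s assume "s \<in> set (inputs ?N (node 3 i))"
        hence "case_sum x (cv x) s = 0\<^sub>v n"
          using that relay[OF that(2) _ char_edgesI(4)[OF that(1)]]
            relay[OF that(2) i char_edgesI(3)[OF that(1)]]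
          by (auto simp: inputs_char_network(4))
        thus "\<exists>n. case_sum x (cv x) s = 0\<^sub>v n" by blast
      qed
      thus ?thesis using that(1) by simp
    qed
    show "x 0 = 0\<^sub>v n" if "x \<in> X" "\<And>i. i \<le> m \<Longrightarrow> G i x = 0\<^sub>v n" for x
    proof -
      have "x (Suc m mod Suc m) = 0\<^sub>v n"
      proof (rule decode[OF that(1) order_refl])
        fix s assume "s \<in> set (inputs ?N (node 3 (Suc m)))"
        then obtain i where i: "i \<le> m" "s = Inr (prod_encode (node 2 i, node 3 (Suc m)))"
          unfolding inputs_char_network(5) by auto
        have "cv x (prod_encode (node 2 i, node 3 (Suc m))) = 0\<^sub>v n"
          using i by (intro relay[OF that(1) _ char_edgesI(5) that(2)]) simp_all
        thus "\<exists>n. case_sum x (cv x) s = 0\<^sub>v n" using i by auto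
      qed
      thus ?thesis by simp
    qed
  qed
  with n show False by simp
qed

theorem theorem3p4:
  shows "CHAR('f::{field,finite}) = CHAR('k::{field,finite}) \<longleftrightarrow>
    (\<forall>N. is_network N \<longrightarrow>
       linear_rate_region TYPE('f) N = linear_rate_region TYPE('k) N)"
proof
  assume ch: "CHAR('f) = CHAR('k)"
  show "\<forall>N. is_network N \<longrightarrow> linear_rate_region TYPE('f) N = linear_rate_region TYPE('k) N"
    using linearly_achievable_same_CHAR[OF ch] linearly_achievable_same_CHAR[OF ch[symmetric]]
    unfolding linear_rate_region_def by blast
next
  assume eq: "\<forall>N. is_network N \<longrightarrow> linear_rate_region TYPE('f) N = linear_rate_region TYPE('k) N"
  \<comment> \<open>The network is taken for the characteristic of \<open>'f\<close>: the all-ones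
    rate vector fails over \<open>'f\<close>, hence over \<open>'k\<close>, so \<open>p\<close> must
    vanish in \<open>'k\<close> as well.\<close>
  define p where "p = CHAR('f)"
  have pos: "CHAR('f) > 0" "CHAR('k) > 0" by (auto intro: finite_imp_CHAR_pos)
  hence prime: "prime CHAR('f)" "prime CHAR('k)" by (auto intro: prime_CHAR_semidom)
  have "\<not> linearly_achievable TYPE('f) (char_network p) (vec (Suc p) (\<lambda>_. 1))"
    by (rule char_network_not_achievable) (use pos in \<open>auto simp: p_def\<close>)
  moreover have "vec (Suc p) (\<lambda>_. 1) \<in> carrier_vec (num_msgs (char_network p))" by simp
  ultimately have "\<not> linearly_achievable TYPE('k) (char_network p) (vec (Suc p) (\<lambda>_. 1))"
    using eq is_network_char_network[of p] unfolding linear_rate_region_def by blast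
  hence "of_nat p = (0 :: 'k)" using char_network_achievable by blast
  hence "CHAR('k) dvd CHAR('f)" by (simp add: of_nat_eq_0_iff_char_dvd p_def)
  with prime(2,1) have "CHAR('k) = CHAR('f)" by (rule primes_dvd_imp_eq)
  thus "CHAR('f) = CHAR('k)" by (rule sym)
qed

end
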